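(* Let $c:S^1_{\ell}\to\mathbb{R}^2$ be a smooth free immersion of length $\ell$ parametrized by arclength, and let $m\in C^\infty(S^1_\ell,\mathbb{R})$ satisfy $\varphi(\ell)\|m\|^2=1$. Then the sectional curvatures $k_c(P(m,h))$ of $G^\varphi$ at $C=\pi(c)$, as $h$ ranges over all functions in $C^\infty(S^1_\ell,\mathbb{R})$ with $\varphi(\ell)\|h\|^2=1$ and $\langle m,h\rangle=0$, are bounded from above if and only if $$\|m\|_\infty^2\le\frac{\varphi'(\ell)}{\varphi(\ell)^2},$$ or, equivalently, if and only if $$m^2(\theta)\le\frac{\varphi'(\ell)\,\ell}{\varphi(\ell)}\,\overline{m^2}\quad\text{for all }\theta,$$ where $\overline{m^2}=\frac1\ell\int_{S^1_\ell}m^2\,d\theta$.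
   Context: $Imm(S^1,\mathbb{R}^2)$ is the space of $C^\infty$ immersions $S^1\to\mathbb{R}^2$; $Imm_f(S^1,\mathbb{R}^2)$ is the subspace of free immersions (those with trivial stabilizer under reparametrization by $Diff(S^1)$), and $B_{i,f}(S^1,\mathbb{R}^2)=Imm_f(S^1,\mathbb{R}^2)/Diff(S^1)$ with projection $\pi$. $\varphi$ is a smooth positive function of the length $\ell$, and $\varphi'=d\varphi/d\ell$. The metric $G^\varphi$ on $B_{i,f}$ is induced from $G^{\varphi}_c(h,k)=\varphi(\ell(c))\int_{S^1}(h\cdot k)|c_\theta|\,d\theta$ on $Imm_f$ by taking components normal to the curve. $S^1_\ell$ is the circle of length $\ell$, $c'$ is the derivative in arclength $\theta$, $n_c=ic'$ is the unit normal (with $\mathbb{R}^2=\mathbb{C}$), $\langle u,v\rangle=\int_{S^1_\ell}uv\,d\theta$, $\|u\|^2=\langle u,u\rangle$, $\|u\|_\infty=\max_\theta|u(\theta)|$. A local chart of $B_{i,f}$ centered at $C=\pi(c)$ is $f\mapsto\pi(c+fn_c)$ for small $f\in C^\infty(S^1_\ell,(-\epsilon,\epsilon))$, so tangent vectors at $C$ are identified with functions $h\in C^\infty(S^1_\ell,\mathbb{R})$ (normal fields $hn_c$). In this chart the metric is $$G^\varphi_f(h,k)=\varphi(\ell_f)\int_{S^1_\ell}\frac{(1-f\kappa_c)^2hk}{\sqrt{(1-f\kappa_c)^2+f'^2}}\,d\theta,\qquad \ell_f=\int_{S^1_\ell}\sqrt{(1-f\kappa_c)^2+f'^2}\,d\theta,$$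 where $\kappa_c$ is the curvature of $c$, defined by $c''=\kappa_c n_c$. $P(m,h)$ is the tangent plane at $C$ spanned by $m,h$. For $m,h$ orthonormal for $G^\varphi_0$ (that is, $\varphi(\ell)\|m\|^2=\varphi(\ell)\|h\|^2=1$ and $\langle m,h\rangle=0$), the sectional curvature is $$k_c(P(m,h))=d_md_hG_0^\varphi(h,m)-\tfrac12\left[d_md_mG_0^\varphi(h,h)+d_hd_hG_0^\varphi(m,m)\right]+G_0^\varphi(\Gamma_0(h,m),\Gamma_0(h,m))-G_0^\varphi(\Gamma_0(m,m),\Gamma_0(h,h)),$$ where $d_j$ denotes the directional derivative with respect to $f$ in direction $j$, the subscript $0$ means evaluation at $f=0$, and $\Gamma$ is determined by $2G_f^\varphi(\Gamma_f(h,k),j)=d_jG_f^\varphi(h,k)-d_hG_f^\varphi(k,j)-d_kG_f^\varphi(h,j)$ for all $j$. *)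

theory Defs
  imports "HOL-Analysis.Analysis"
begin

text \<open>
  The circle \<open>S\<^sup>1\<^sub>L\<close> of length \<open>L\<close> is \<open>\<real>/L\<int>\<close>, maps on it are \<open>L\<close>-periodic maps on \<open>\<real>\<close>, and the plane
  is \<open>\<complex>\<close>.
\<close>

definition smooth_on :: "real set \<Rightarrow> (real \<Rightarrow> 'a::real_normed_vector) \<Rightarrow> bool" where
  "smooth_on S u \<longleftrightarrow>
     (\<forall>n. \<forall>x\<in>S. ((\<lambda>v t. vector_derivative v (at t)) ^^ n) u differentiable (at x))"

definition circle_smooth :: "real \<Rightarrow> (real \<Rightarrow> 'a::real_normed_vector) set" where
  "circle_smooth L = {u. smooth_on UNIV u \<and> (\<forall>\<theta>. u (\<theta> + L) = u \<theta>)}"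

text \<open>
  A diffeomorphism of the circle is given by a lift to \<open>\<real>\<close>; both orientations are allowed.
  Bijectivity of the lift and smoothness of its inverse follow from the conditions below.
\<close>

definition circle_diffeo :: "real \<Rightarrow> (real \<Rightarrow> real) \<Rightarrow> bool" where
  "circle_diffeo L \<psi> \<longleftrightarrow> smooth_on UNIV \<psi> \<and> (\<forall>\<theta>. deriv \<psi> \<theta> \<noteq> 0) \<and>
     ((\<forall>\<theta>. \<psi> (\<theta> + L) = \<psi> \<theta> + L) \<or> (\<forall>\<theta>. \<psi> (\<theta> + L) = \<psi> \<theta> - L))"

abbreviation velocity :: "(real \<Rightarrow> complex) \<Rightarrow> real \<Rightarrow> complex" where
  "velocity \<gamma> \<theta> \<equiv> vector_derivative \<gamma> (at \<theta>)"

definition immersion :: "real \<Rightarrow> (real \<Rightarrow> complex) \<Rightarrow> bool" where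
  "immersion L c \<longleftrightarrow> c \<in> circle_smooth L \<and> (\<forall>\<theta>. velocity c \<theta> \<noteq> 0)"

text \<open>The lifts of the identity of the circle are the translations by integer multiples of \<open>L\<close>.\<close>

definition free_immersion :: "real \<Rightarrow> (real \<Rightarrow> complex) \<Rightarrow> bool" where
  "free_immersion L c \<longleftrightarrow> immersion L c \<and>
     (\<forall>\<psi>. circle_diffeo L \<psi> \<and> c \<circ> \<psi> = c \<longrightarrow> (\<exists>k::int. \<forall>\<theta>. \<psi> \<theta> = \<theta> + of_int k * L))"

definition arclength_param :: "(real \<Rightarrow> complex) \<Rightarrow> bool" where
  "arclength_param c \<longleftrightarrow> (\<forall>\<theta>. norm (velocity c \<theta>) = 1)"

definition curve_length :: "real \<Rightarrow> (real \<Rightarrow> complex) \<Rightarrow> real" where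
  "curve_length L \<gamma> = integral {0..L} (\<lambda>\<theta>. norm (velocity \<gamma> \<theta>))"

definition unit_normal :: "(real \<Rightarrow> complex) \<Rightarrow> real \<Rightarrow> complex" where
  "unit_normal \<gamma> \<theta> = \<i> * sgn (velocity \<gamma> \<theta>)"

definition curvature :: "(real \<Rightarrow> complex) \<Rightarrow> real \<Rightarrow> real" where
  "curvature c \<theta> = (THE k. velocity (velocity c) \<theta> = of_real k * unit_normal c \<theta>)"

definition normal_part :: "(real \<Rightarrow> complex) \<Rightarrow> (real \<Rightarrow> complex) \<Rightarrow> real \<Rightarrow> complex" where
  "normal_part \<gamma> X \<theta> = of_real (X \<theta> \<bullet> unit_normal \<gamma> \<theta>) * unit_normal \<gamma> \<theta>"

definition imm_metric ::
  "(real \<Rightarrow> real) \<Rightarrow> real \<Rightarrow> (real \<Rightarrow> complex) \<Rightarrow> (real \<Rightarrow> complex) \<Rightarrow> (real \<Rightarrow> complex) \<Rightarrow> real" where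
  "imm_metric \<phi> L \<gamma> X Y =
     \<phi> (curve_length L \<gamma>) * integral {0..L} (\<lambda>\<theta>. (X \<theta> \<bullet> Y \<theta>) * norm (velocity \<gamma> \<theta>))"

definition normal_field :: "(real \<Rightarrow> complex) \<Rightarrow> (real \<Rightarrow> real) \<Rightarrow> real \<Rightarrow> complex" where
  "normal_field c h \<theta> = of_real (h \<theta>) * unit_normal c \<theta>"

definition chart :: "(real \<Rightarrow> complex) \<Rightarrow> (real \<Rightarrow> real) \<Rightarrow> real \<Rightarrow> complex" where
  "chart c f \<theta> = c \<theta> + normal_field c f \<theta>"

text \<open>
  The induced metric on the quotient by reparametrizations, in the chart centered at \<open>c\<close>. The
  derivative of the chart at \<open>f\<close> sends \<open>h\<close> to the field \<open>h n\<^sub>c\<close> along \<open>c + f n\<^sub>c\<close>, whose component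
  normal to that curve is taken. The resulting coordinate formula is the lemma
  \<open>chart_metric_formula\<close> below.
\<close>

definition chart_metric ::
  "(real \<Rightarrow> real) \<Rightarrow> real \<Rightarrow> (real \<Rightarrow> complex) \<Rightarrow>
   (real \<Rightarrow> real) \<Rightarrow> (real \<Rightarrow> real) \<Rightarrow> (real \<Rightarrow> real) \<Rightarrow> real" where
  "chart_metric \<phi> L c f h k =
     imm_metric \<phi> L (chart c f)
       (normal_part (chart c f) (normal_field c h)) (normal_part (chart c f) (normal_field c k))"

definition dir_deriv ::
  "(real \<Rightarrow> real) \<Rightarrow> ((real \<Rightarrow> real) \<Rightarrow> real) \<Rightarrow> (real \<Rightarrow> real) \<Rightarrow> real" where
  "dir_deriv j F f = deriv (\<lambda>t. F (\<lambda>\<theta>. f \<theta> + t * j \<theta>)) 0"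

text \<open>
  The sign is opposite to that of the usual Christoffel symbols; the curvature is quadratic in
  \<open>\<Gamma>\<close>, so it is unaffected.
\<close>

definition christoffel ::
  "(real \<Rightarrow> real) \<Rightarrow> real \<Rightarrow> (real \<Rightarrow> complex) \<Rightarrow>
   (real \<Rightarrow> real) \<Rightarrow> (real \<Rightarrow> real) \<Rightarrow> (real \<Rightarrow> real) \<Rightarrow> real \<Rightarrow> real" where
  "christoffel \<phi> L c f h k =
     (let G = chart_metric \<phi> L c in
      THE g. g \<in> circle_smooth L \<and>
        (\<forall>j \<in> circle_smooth L.
           2 * G f g j =
             dir_deriv j (\<lambda>f. G f h k) f - dir_deriv h (\<lambda>f. G f k j) f - dir_deriv k (\<lambda>f. G f h j) f))"

text \<open>
  Sectional curvature at the center of the chart of the plane spanned by \<open>m\<close> and \<open>h\<close>, for \<open>m\<close>, \<open>h\<close>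
  orthonormal with respect to the metric there.
\<close>

definition sectional_curvature ::
  "(real \<Rightarrow> real) \<Rightarrow> real \<Rightarrow> (real \<Rightarrow> complex) \<Rightarrow> (real \<Rightarrow> real) \<Rightarrow> (real \<Rightarrow> real) \<Rightarrow> real" where
  "sectional_curvature \<phi> L c m h =
     (let G = chart_metric \<phi> L c; z = (\<lambda>_. 0); \<Gamma> = christoffel \<phi> L c z in
      dir_deriv m (dir_deriv h (\<lambda>f. G f h m)) z
      - 1/2 * (dir_deriv m (dir_deriv m (\<lambda>f. G f h h)) z + dir_deriv h (dir_deriv h (\<lambda>f. G f m m)) z)
      + G z (\<Gamma> h m) (\<Gamma> h m) - G z (\<Gamma> m m) (\<Gamma> h h))"

definition circle_inner :: "real \<Rightarrow> (real \<Rightarrow> real) \<Rightarrow> (real \<Rightarrow> real) \<Rightarrow> real" where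
  "circle_inner L u v = integral {0..L} (\<lambda>\<theta>. u \<theta> * v \<theta>)"

definition sup_norm :: "(real \<Rightarrow> real) \<Rightarrow> real" where
  "sup_norm u = (SUP \<theta>. \<bar>u \<theta>\<bar>)"

lemma smooth_on_vector_derivative:
  assumes "smooth_on S u"
  shows "smooth_on S (\<lambda>t. vector_derivative u (at t))"
  unfolding smooth_on_def
proof (intro allI ballI)
  fix n x assume "x \<in> S"
  have "((\<lambda>v t. vector_derivative v (at t)) ^^ Suc n) u differentiable (at x)"
    using assms \<open>x \<in> S\<close> unfolding smooth_on_def by blast
  then show "((\<lambda>v t. vector_derivative v (at t)) ^^ n) (\<lambda>t. vector_derivative u (at t))
      differentiable (at x)"
    by (simp only: funpow_Suc_right o_def)
qed

lemma smooth_on_has_vector_derivative: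
  assumes "smooth_on S u" "x \<in> S"
  shows "(u has_vector_derivative vector_derivative u (at x)) (at x)"
proof -
  have "((\<lambda>v t. vector_derivative v (at t)) ^^ 0) u differentiable (at x)"
    using assms unfolding smooth_on_def by blast
  then show ?thesis by (simp add: vector_derivative_works)
qed

lemma smooth_on_has_real_derivative:
  fixes u :: "real \<Rightarrow> real"
  assumes "smooth_on S u" "x \<in> S"
  shows "(u has_real_derivative deriv u x) (at x)"
  using smooth_on_has_vector_derivative[OF assms]
  by (metis DERIV_imp_deriv has_real_derivative_iff_has_vector_derivative)

context
  fixes L :: real and c :: "real \<Rightarrow> complex"
  assumes c: "c \<in> circle_smooth L" and arc: "arclength_param c"
begin

lemma norm_velocity_arclength: "norm (velocity c \<theta>) = 1"
  using arc by (simp add: arclength_param_def)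

lemma unit_normal_arclength: "unit_normal c \<theta> = \<i> * velocity c \<theta>"
  by (simp add: unit_normal_def sgn_div_norm norm_velocity_arclength)

lemma curvature_arclength: "velocity (velocity c) \<theta> = of_real (curvature c \<theta>) * unit_normal c \<theta>"
proof -
  let ?v = "velocity c" and ?a = "velocity (velocity c) \<theta>"
  have "(?v has_vector_derivative ?a) (at \<theta>)"
    using c smooth_on_has_vector_derivative[OF smooth_on_vector_derivative]
    unfolding circle_smooth_def by blast
  then have "((\<lambda>t. ?v t \<bullet> ?v t) has_derivative (\<lambda>s. ?v \<theta> \<bullet> (s *\<^sub>R ?a) + (s *\<^sub>R ?a) \<bullet> ?v \<theta>)) (at \<theta>)"
    unfolding has_vector_derivative_def by (intro has_derivative_inner)
  moreover have "(\<lambda>t. ?v t \<bullet> ?v t) = (\<lambda>_. 1)"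
    using norm_velocity_arclength by (simp add: dot_square_norm)
  ultimately have "((\<lambda>_. 1::real) has_derivative (\<lambda>s. ?v \<theta> \<bullet> (s *\<^sub>R ?a) + (s *\<^sub>R ?a) \<bullet> ?v \<theta>)) (at \<theta>)"
    by simp
  from has_derivative_unique[OF this has_derivative_const]
  have "?v \<theta> \<bullet> (1 *\<^sub>R ?a) + (1 *\<^sub>R ?a) \<bullet> ?v \<theta> = 0" by (rule fun_cong)
  then have orth: "Re (?v \<theta>) * Re ?a + Im (?v \<theta>) * Im ?a = 0"
    by (simp add: inner_commute inner_complex_def)
  have unit: "Re (?v \<theta>) * Re (?v \<theta>) + Im (?v \<theta>) * Im (?v \<theta>) = 1"
    using norm_velocity_arclength[of \<theta>]
    by (metis dot_square_norm inner_complex_def power_one)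
  define k where "k = Re (?v \<theta>) * Im ?a - Im (?v \<theta>) * Re ?a"
  have "Re ?a * (Re (?v \<theta>) * Re (?v \<theta>) + Im (?v \<theta>) * Im (?v \<theta>)) =
      - (k * Im (?v \<theta>)) + Re (?v \<theta>) * (Re (?v \<theta>) * Re ?a + Im (?v \<theta>) * Im ?a)"
    by (simp add: k_def algebra_simps)
  then have re: "Re ?a = - (k * Im (?v \<theta>))" by (simp add: orth unit)
  have "Im ?a * (Re (?v \<theta>) * Re (?v \<theta>) + Im (?v \<theta>) * Im (?v \<theta>)) =
      k * Re (?v \<theta>) + Im (?v \<theta>) * (Re (?v \<theta>) * Re ?a + Im (?v \<theta>) * Im ?a)"
    by (simp add: k_def algebra_simps)
  then have im: "Im ?a = k * Re (?v \<theta>)" by (simp add: orth unit)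
  have "?a = of_real k * (\<i> * ?v \<theta>)"
    by (rule complex_eqI) (simp_all add: re im)
  then have "?a = of_real k * unit_normal c \<theta>" by (simp add: unit_normal_arclength)
  moreover have "unit_normal c \<theta> \<noteq> 0"
    using norm_velocity_arclength[of \<theta>] by (auto simp: unit_normal_arclength)
  ultimately show ?thesis
    unfolding curvature_def by (rule_tac theI[of _ k]) auto
qed

lemma chart_velocity:
  assumes f: "f \<in> circle_smooth L"
  shows "velocity (chart c f) \<theta> =
    (of_real (1 - f \<theta> * curvature c \<theta>) + \<i> * of_real (deriv f \<theta>)) * velocity c \<theta>"
proof -
  let ?v = "velocity c"
  have 1: "(c has_vector_derivative ?v \<theta>) (at \<theta>)"
    using c smooth_on_has_vector_derivative unfolding circle_smooth_def by blast
  have 2: "(?v has_vector_derivative velocity ?v \<theta>) (at \<theta>)"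
    using c smooth_on_has_vector_derivative[OF smooth_on_vector_derivative]
    unfolding circle_smooth_def by blast
  have 3: "((\<lambda>t. complex_of_real (f t)) has_vector_derivative of_real (deriv f \<theta>)) (at \<theta>)"
    using f smooth_on_has_real_derivative unfolding circle_smooth_def
    by (intro has_vector_derivative_of_real) (auto simp: has_real_derivative_iff_has_vector_derivative)
  have "((\<lambda>t. c t + of_real (f t) * (\<i> * ?v t)) has_vector_derivative
     ?v \<theta> + (of_real (f \<theta>) * (\<i> * velocity ?v \<theta>) + of_real (deriv f \<theta>) * (\<i> * ?v \<theta>))) (at \<theta>)"
    by (rule has_vector_derivative_add[OF 1 has_vector_derivative_mult[OF 3 has_vector_derivative_mult_right[OF 2]]])
  moreover have "chart c f = (\<lambda>t. c t + of_real (f t) * (\<i> * ?v t))"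
    by (simp add: fun_eq_iff chart_def normal_field_def unit_normal_arclength)
  moreover have "?v \<theta> + (of_real (f \<theta>) * (\<i> * velocity ?v \<theta>) + of_real (deriv f \<theta>) * (\<i> * ?v \<theta>)) =
     (of_real (1 - f \<theta> * curvature c \<theta>) + \<i> * of_real (deriv f \<theta>)) * ?v \<theta>"
    unfolding curvature_arclength unit_normal_arclength
    by (rule complex_eqI) (simp_all add: algebra_simps)
  ultimately show ?thesis by (simp add: vector_derivative_at)
qed

lemma chart_speed:
  assumes f: "f \<in> circle_smooth L"
  shows "norm (velocity (chart c f) \<theta>) = sqrt ((1 - f \<theta> * curvature c \<theta>)\<^sup>2 + (deriv f \<theta>)\<^sup>2)"
  unfolding chart_velocity[OF f] norm_mult norm_velocity_arclength by (simp add: cmod_def)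

lemma normal_part_chart_inner:
  assumes f: "f \<in> circle_smooth L"
  defines "W \<equiv> \<lambda>\<theta>. 1 - f \<theta> * curvature c \<theta>"
  shows "(normal_part (chart c f) (normal_field c h) \<theta> \<bullet> normal_part (chart c f) (normal_field c k) \<theta>)
      * norm (velocity (chart c f) \<theta>) =
    (W \<theta>)\<^sup>2 * h \<theta> * k \<theta> / sqrt ((W \<theta>)\<^sup>2 + (deriv f \<theta>)\<^sup>2)"
proof -
  let ?v = "velocity c \<theta>" and ?g = "velocity (chart c f) \<theta>" and ?n = "unit_normal (chart c f) \<theta>"
  define s where "s = sqrt ((W \<theta>)\<^sup>2 + (deriv f \<theta>)\<^sup>2)"
  have s: "norm ?g = s" using chart_speed[OF f] by (simp add: s_def W_def)
  have unit: "Re ?v * Re ?v + Im ?v * Im ?v = 1"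
    using norm_velocity_arclength[of \<theta>]
    by (metis dot_square_norm inner_complex_def power_one)
  have n: "?n = of_real (1 / s) * (\<i> * ((of_real (W \<theta>) + \<i> * of_real (deriv f \<theta>)) * ?v))"
    unfolding unit_normal_def sgn_div_norm s
    unfolding chart_velocity[OF f] W_def scaleR_conv_of_real
    by (simp add: divide_inverse mult.left_commute)
  have proj: "normal_field c u \<theta> \<bullet> ?n = u \<theta> * W \<theta> / s" for u
  proof -
    have "(\<i> * ?v) \<bullet> (\<i> * ((of_real (W \<theta>) + \<i> * of_real (deriv f \<theta>)) * ?v)) =
        W \<theta> * (Re ?v * Re ?v + Im ?v * Im ?v)"
      by (simp add: inner_complex_def algebra_simps)
    then have "(\<i> * ?v) \<bullet> (\<i> * ((of_real (W \<theta>) + \<i> * of_real (deriv f \<theta>)) * ?v)) = W \<theta>"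
      by (simp add: unit)
    then have "(u \<theta> *\<^sub>R (\<i> * ?v)) \<bullet> ((1 / s) *\<^sub>R (\<i> * ((of_real (W \<theta>) + \<i> * of_real (deriv f \<theta>)) * ?v)))
        = u \<theta> * W \<theta> / s"
      by simp
    then show ?thesis
      unfolding n normal_field_def unit_normal_arclength scaleR_conv_of_real .
  qed
  show ?thesis
  proof (cases "s = 0")
    case True
    then show ?thesis using s by (simp add: s_def)
  next
    case False
    then have "?g \<noteq> 0" using s by auto
    then have "?n \<bullet> ?n = 1"
      by (simp add: unit_normal_def dot_square_norm norm_mult norm_sgn)
    then have "normal_part (chart c f) (normal_field c h) \<theta> \<bullet> normal_part (chart c f) (normal_field c k) \<theta>
        = (h \<theta> * W \<theta> / s) * (k \<theta> * W \<theta> / s)"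
      unfolding normal_part_def proj scaleR_conv_of_real[symmetric] by simp
    then show ?thesis using False
      unfolding s s_def[symmetric] by (simp add: power2_eq_square)
  qed
qed

lemma chart_metric_formula:
  assumes f: "f \<in> circle_smooth L"
  shows "chart_metric \<phi> L c f h k =
    \<phi> (integral {0..L} (\<lambda>\<theta>. sqrt ((1 - f \<theta> * curvature c \<theta>)\<^sup>2 + (deriv f \<theta>)\<^sup>2))) *
    integral {0..L} (\<lambda>\<theta>. (1 - f \<theta> * curvature c \<theta>)\<^sup>2 * h \<theta> * k \<theta> /
                             sqrt ((1 - f \<theta> * curvature c \<theta>)\<^sup>2 + (deriv f \<theta>)\<^sup>2))"
  unfolding chart_metric_def imm_metric_def curve_length_def
    chart_speed[OF f] normal_part_chart_inner[OF f, unfolded chart_speed[OF f]] ..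

end

end

theory Submission
  imports Defs
begin

text \<open>
  Write \<open>\<kappa>\<close> for the curvature of the curve and \<open>a = \<phi>(L) m\<^sup>2 - \<phi>'(L) / \<phi>(L)\<close>. The curvature is
  \<open>1/2 \<integral> a h'\<^sup>2 + R(h)\<close> with a remainder \<open>R\<close> that is bounded on the unit sphere orthogonal to \<open>m\<close>,
  so everything hinges on the sign of \<open>a\<close>.

  The leading term comes from the second derivatives of the metric. To second order in the chart
  variable \<open>f\<close>, the density \<open>(1 - f\<kappa>)\<^sup>2 / sqrt ((1 - f\<kappa>)\<^sup>2 + f'\<^sup>2)\<close> is \<open>1 - f\<kappa> - f'\<^sup>2 / 2\<close> and the
  length is \<open>L - \<integral> f\<kappa> + 1/2 \<integral> f'\<^sup>2\<close>. In \<open>- 1/2 d\<^sub>h d\<^sub>h G(m,m)\<close> the density therefore contributes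
  \<open>\<phi>/2 \<integral> m\<^sup>2 h'\<^sup>2\<close>, and the growth of the length under oscillation contributes
  \<open>- \<phi>'/2 \<integral> h'\<^sup>2 \<cdot> \<integral> m\<^sup>2\<close>. The only other place where a derivative of \<open>h\<close> occurs is
  \<open>- \<phi> \<integral> m m' h h'\<close>, and an integration by parts removes it from there. The symbols \<open>\<Gamma>\<close> at the center
  are algebraic in their arguments and their integrals, so the two \<open>\<Gamma>\<close> terms of the curvature are
  bounded when \<open>h\<close> is bounded in \<open>L\<^sup>2\<close> (\<open>sectional_curvature_eq\<close>,
  \<open>curvature_remainder_bounded\<close>).

  If \<open>a \<le> 0\<close> everywhere, the leading term is nonpositive and the curvatures are bounded above. If \<open>a\<close>
  is positive somewhere, choose \<open>g\<close> concentrated near the maximum of \<open>a\<close> so that \<open>\<integral> a g\<^sup>2 > 0\<close>, and let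
  \<open>h\<close> be proportional to \<open>g\<close> times a wave of frequency \<open>k\<close>. The phase of the wave is a free parameter
  that can be spent on making \<open>h\<close> orthogonal to \<open>m\<close>, and \<open>\<integral> a h'\<^sup>2\<close> grows like
  \<open>k\<^sup>2 / 2 \<cdot> \<integral> a g\<^sup>2\<close> as \<open>k\<close> tends to infinity (\<open>high_energy_orthogonal\<close>).

  Both inequalities of the criterion say \<open>a \<le> 0\<close>, because the normalization of \<open>m\<close> gives
  \<open>\<integral> m\<^sup>2 = 1 / \<phi>(L)\<close>.
\<close>

section \<open>Smooth functions on the circle\<close>

text \<open>
  A class of functions in which every member has a derivative that is again a member consists of
  smooth functions. This avoids all formulas for higher derivatives: a closure property of smoothness
  only needs a class that is stable under one differentiation.
\<close>

lemma smooth_coinduct: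
  fixes u :: "real \<Rightarrow> 'a::real_normed_vector"
  assumes "u \<in> S"
    and step: "\<And>v. v \<in> S \<Longrightarrow> \<exists>v'\<in>S. \<forall>x. (v has_vector_derivative v' x) (at x)"
  shows "smooth_on UNIV u"
proof -
  let ?D = "\<lambda>v t. vector_derivative v (at t)"
  have D: "?D v \<in> S" if v: "v \<in> S" for v
  proof -
    obtain v' where v': "v' \<in> S" "\<forall>x. (v has_vector_derivative v' x) (at x)"
      using step[OF v] by blast
    then have "?D v = v'" by (auto simp: vector_derivative_at)
    with v' show ?thesis by simp
  qed
  have "(?D ^^ n) u \<in> S" for n
    by (induction n) (use \<open>u \<in> S\<close> D in auto)
  then show ?thesis
    unfolding smooth_on_def by (metis step differentiableI_vector)
qed

lemma smooth_const: "smooth_on UNIV (\<lambda>x. k)"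
  by (rule smooth_coinduct[where S = "range (\<lambda>k x. k)"]) (auto intro: has_vector_derivative_const)

lemma smooth_add:
  assumes "smooth_on UNIV u" "smooth_on UNIV v"
  shows "smooth_on UNIV (\<lambda>x. u x + v x)"
proof (rule smooth_coinduct[where S = "{\<lambda>x. u x + v x | u v. smooth_on UNIV u \<and> smooth_on UNIV v}"])
  fix w :: "real \<Rightarrow> 'a" assume "w \<in> {\<lambda>x. u x + v x | u v. smooth_on UNIV u \<and> smooth_on UNIV v}"
  then obtain u v where w: "w = (\<lambda>x. u x + v x)" and u: "smooth_on UNIV u" and v: "smooth_on UNIV v"
    by auto
  show "\<exists>w'\<in>{\<lambda>x. u x + v x | u v. smooth_on UNIV u \<and> smooth_on UNIV v}.
      \<forall>x. (w has_vector_derivative w' x) (at x)"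
    unfolding w
    by (rule bexI[where x = "\<lambda>x. vector_derivative u (at x) + vector_derivative v (at x)"])
      (use u[THEN smooth_on_vector_derivative] v[THEN smooth_on_vector_derivative] in
        \<open>auto intro: has_vector_derivative_add smooth_on_has_vector_derivative[OF u]
          smooth_on_has_vector_derivative[OF v]\<close>)
qed (use assms in auto)

lemma smooth_bounded_linear:
  assumes f: "bounded_linear f" and u: "smooth_on UNIV u"
  shows "smooth_on UNIV (\<lambda>x. f (u x))"
proof (rule smooth_coinduct[where S = "{\<lambda>x. f (u x) | u. smooth_on UNIV u}"])
  fix w assume "w \<in> {\<lambda>x. f (u x) | u. smooth_on UNIV u}"
  then obtain u where w: "w = (\<lambda>x. f (u x))" and u: "smooth_on UNIV u"
    by auto
  show "\<exists>w'\<in>{\<lambda>x. f (u x) | u. smooth_on UNIV u}. \<forall>x. (w has_vector_derivative w' x) (at x)"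
    unfolding w
    by (rule bexI[where x = "\<lambda>x. f (vector_derivative u (at x))"])
      (use u in \<open>auto intro!: bounded_linear.has_vector_derivative[OF f] smooth_on_has_vector_derivative
        dest: smooth_on_vector_derivative\<close>)
qed (use u in auto)

text \<open>
  Products of smooth functions are not stable under differentiation, because the product rule
  produces a sum of two of them; finite sums of products are.
\<close>

inductive_set product_sums :: "(real \<Rightarrow> real) set" where
  product: "smooth_on UNIV u \<Longrightarrow> smooth_on UNIV v \<Longrightarrow> (\<lambda>x. u x * v x) \<in> product_sums"
| sum: "u \<in> product_sums \<Longrightarrow> v \<in> product_sums \<Longrightarrow> (\<lambda>x. u x + v x) \<in> product_sums"

lemma product_sums_derivative:
  assumes "w \<in> product_sums"
  shows "\<exists>w'\<in>product_sums. \<forall>x. (w has_vector_derivative w' x) (at x)"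
  using assms
proof induction
  case (product u v)
  let ?d = "\<lambda>u x. vector_derivative u (at x)"
  have "(\<lambda>x. u x * ?d v x + ?d u x * v x) \<in> product_sums"
    using product by (intro product_sums.intros smooth_on_vector_derivative)
  moreover have "((\<lambda>x. u x * v x) has_vector_derivative u x * ?d v x + ?d u x * v x) (at x)" for x
    using product by (intro has_vector_derivative_mult smooth_on_has_vector_derivative) auto
  ultimately show ?case by (intro bexI allI)
next
  case (sum u v)
  then obtain u' v' where "u' \<in> product_sums" "v' \<in> product_sums"
      "\<forall>x. (u has_vector_derivative u' x) (at x)" "\<forall>x. (v has_vector_derivative v' x) (at x)"
    by blast
  then show ?case
    by (intro bexI[where x = "\<lambda>x. u' x + v' x"] product_sums.sum) (auto intro: has_vector_derivative_add)
qed

lemma smooth_mult: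
  fixes u v :: "real \<Rightarrow> real"
  assumes "smooth_on UNIV u" "smooth_on UNIV v"
  shows "smooth_on UNIV (\<lambda>x. u x * v x)"
  by (rule smooth_coinduct[OF product_sums.product[OF assms] product_sums_derivative])

lemma smooth_exp:
  fixes u :: "real \<Rightarrow> real"
  assumes u: "smooth_on UNIV u"
  shows "smooth_on UNIV (\<lambda>x. exp (u x))"
proof (rule smooth_coinduct[where S = "{\<lambda>x. p x * exp (u x) | p. smooth_on UNIV p}"])
  show "(\<lambda>x. exp (u x)) \<in> {\<lambda>x. p x * exp (u x) | p. smooth_on UNIV p}"
    using smooth_const[of "1::real"] by force
next
  fix w assume "w \<in> {\<lambda>x. p x * exp (u x) | p. smooth_on UNIV p}"
  then obtain p where w: "w = (\<lambda>x. p x * exp (u x))" and p: "smooth_on UNIV p"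
    by auto
  let ?d = "\<lambda>u x. vector_derivative u (at x)"
  have "(w has_vector_derivative (?d p x + p x * ?d u x) * exp (u x)) (at x)" for x
  proof -
    have "(p has_real_derivative ?d p x) (at x)" "(u has_real_derivative ?d u x) (at x)"
      using smooth_on_has_vector_derivative[OF p] smooth_on_has_vector_derivative[OF u]
      by (simp_all add: has_real_derivative_iff_has_vector_derivative)
    from DERIV_mult[OF this(1) DERIV_chain2[OF DERIV_exp this(2)]]
    show ?thesis
      unfolding w has_real_derivative_iff_has_vector_derivative[symmetric]
      by (simp add: algebra_simps)
  qed
  moreover have "smooth_on UNIV (\<lambda>x. ?d p x + p x * ?d u x)"
    using p u by (intro smooth_add smooth_mult smooth_on_vector_derivative)
  ultimately show "\<exists>w'\<in>{\<lambda>x. p x * exp (u x) | p. smooth_on UNIV p}.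
      \<forall>x. (w has_vector_derivative w' x) (at x)"
    by (intro bexI[where x = "\<lambda>x. (?d p x + p x * ?d u x) * exp (u x)"] allI) auto
qed

lemma smooth_oscillation:
  fixes k :: real
  shows "smooth_on UNIV (\<lambda>x. \<alpha> * cos (k * x) + \<beta> * sin (k * x))"
proof (rule smooth_coinduct[where S = "range (\<lambda>(\<alpha>, \<beta>) x. \<alpha> * cos (k * x) + \<beta> * sin (k * x))"])
  fix w assume "w \<in> range (\<lambda>(\<alpha>, \<beta>) x. \<alpha> * cos (k * x) + \<beta> * sin (k * x))"
  then obtain \<alpha> \<beta> where w: "w = (\<lambda>x. \<alpha> * cos (k * x) + \<beta> * sin (k * x))" by auto
  have "(w has_vector_derivative \<beta> * k * cos (k * x) + (- \<alpha> * k) * sin (k * x)) (at x)" for x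
    unfolding w has_real_derivative_iff_has_vector_derivative[symmetric]
    by (auto intro!: derivative_eq_intros simp: algebra_simps)
  then show "\<exists>w'\<in>range (\<lambda>(\<alpha>, \<beta>) x. \<alpha> * cos (k * x) + \<beta> * sin (k * x)).
      \<forall>x. (w has_vector_derivative w' x) (at x)"
    by (intro bexI[where x = "\<lambda>x. \<beta> * k * cos (k * x) + (- \<alpha> * k) * sin (k * x)"])
      (auto intro!: image_eqI[where x = "(\<beta> * k, - \<alpha> * k)"])
qed (auto intro!: image_eqI[where x = "(\<alpha>, \<beta>)"])

lemma deriv_eq_vector_derivative:
  fixes u :: "real \<Rightarrow> real"
  shows "deriv u = (\<lambda>x. vector_derivative u (at x))"
  by (simp add: fun_eq_iff deriv_def vector_derivative_def has_real_derivative_iff_has_vector_derivative)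

lemma circle_smooth_const: "(\<lambda>x. k) \<in> circle_smooth L"
  by (simp add: circle_smooth_def smooth_const)

lemma circle_smooth_add:
  "u \<in> circle_smooth L \<Longrightarrow> v \<in> circle_smooth L \<Longrightarrow> (\<lambda>x. u x + v x) \<in> circle_smooth L"
  by (simp add: circle_smooth_def smooth_add)

lemma circle_smooth_mult:
  fixes u v :: "real \<Rightarrow> real"
  shows "u \<in> circle_smooth L \<Longrightarrow> v \<in> circle_smooth L \<Longrightarrow> (\<lambda>x. u x * v x) \<in> circle_smooth L"
  by (simp add: circle_smooth_def smooth_mult)

lemma circle_smooth_diff:
  fixes u v :: "real \<Rightarrow> real"
  assumes "u \<in> circle_smooth L" "v \<in> circle_smooth L"
  shows "(\<lambda>x. u x - v x) \<in> circle_smooth L"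
  using circle_smooth_add[OF assms(1) circle_smooth_mult[OF circle_smooth_const[of "-1"] assms(2)]]
  by simp

lemma circle_smooth_vector_derivative:
  assumes u: "u \<in> circle_smooth L"
  shows "(\<lambda>x. vector_derivative u (at x)) \<in> circle_smooth L"
proof -
  have s: "smooth_on UNIV u" and per: "u (x + L) = u x" for x
    using u by (auto simp: circle_smooth_def)
  have "vector_derivative u (at (x + L)) = vector_derivative u (at x)" for x
  proof -
    have "(u has_vector_derivative vector_derivative u (at (x + L))) (at (x + L))"
      using smooth_on_has_vector_derivative[OF s] by simp
    then have "((u \<circ> (\<lambda>x. x + L)) has_vector_derivative 1 *\<^sub>R vector_derivative u (at (x + L))) (at x)"
      by (intro vector_diff_chain_at) (auto intro!: derivative_eq_intros)
    moreover have "u \<circ> (\<lambda>x. x + L) = u" using per by auto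
    ultimately show ?thesis by (simp add: vector_derivative_at)
  qed
  then show ?thesis using s smooth_on_vector_derivative by (auto simp: circle_smooth_def)
qed

lemma circle_smooth_deriv:
  fixes u :: "real \<Rightarrow> real"
  shows "u \<in> circle_smooth L \<Longrightarrow> deriv u \<in> circle_smooth L"
  unfolding deriv_eq_vector_derivative by (rule circle_smooth_vector_derivative)

lemma circle_smooth_has_derivative:
  fixes u :: "real \<Rightarrow> real"
  shows "u \<in> circle_smooth L \<Longrightarrow> (u has_real_derivative deriv u x) (at x)"
  using smooth_on_has_real_derivative[of UNIV u x] by (simp add: circle_smooth_def)

lemma circle_smooth_continuous:
  fixes u :: "real \<Rightarrow> real"
  shows "u \<in> circle_smooth L \<Longrightarrow> continuous_on A u"
  by (meson DERIV_isCont circle_smooth_has_derivative continuous_at_imp_continuous_on)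

lemma circle_smooth_periodic_int:
  assumes u: "u \<in> circle_smooth L"
  shows "u (x + of_int k * L) = u x"
proof -
  have nat: "u (x + of_nat n * L) = u x" for n x
  proof (induction n)
    case (Suc n)
    have "u (x + of_nat (Suc n) * L) = u ((x + of_nat n * L) + L)" by (simp add: algebra_simps)
    also have "\<dots> = u (x + of_nat n * L)" using u by (simp add: circle_smooth_def)
    finally show ?case using Suc by simp
  qed simp
  show ?thesis
  proof (cases k)
    case (nonneg n)
    then show ?thesis using nat by simp
  next
    case (neg n)
    have "u x = u ((x + of_int k * L) + of_nat (Suc n) * L)" by (simp add: neg algebra_simps)
    also have "\<dots> = u (x + of_int k * L)" by (rule nat)
    finally show ?thesis by simp
  qed
qed

lemma circle_smooth_representative:
  assumes u: "u \<in> circle_smooth L" and L: "L > 0"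
  obtains y where "y \<in> {0..L}" "u y = u x"
proof
  let ?y = "x + of_int (- \<lfloor>x / L\<rfloor>) * L"
  have "of_int \<lfloor>x / L\<rfloor> * L \<le> x" "x \<le> (of_int \<lfloor>x / L\<rfloor> + 1) * L"
    using floor_divide_lower[OF L, of x] floor_divide_upper[OF L, of x] by simp_all
  then show "?y \<in> {0..L}" by (simp add: algebra_simps)
  show "u ?y = u x" by (rule circle_smooth_periodic_int[OF u])
qed

lemma circle_smooth_bounded:
  fixes u :: "real \<Rightarrow> real"
  assumes u: "u \<in> circle_smooth L" and L: "L > 0"
  obtains B where "B \<ge> 0" "\<And>x. \<bar>u x\<bar> \<le> B"
proof -
  have "compact (u ` {0..L})"
    by (intro compact_continuous_image circle_smooth_continuous[OF u]) simp
  then obtain B where B: "\<forall>y\<in>u ` {0..L}. norm y \<le> B"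
    using compact_imp_bounded bounded_iff by blast
  have "\<bar>u x\<bar> \<le> B" for x
  proof -
    obtain y where "y \<in> {0..L}" "u y = u x" using circle_smooth_representative[OF u L] .
    then have "norm (u x) \<le> B" using B by (metis imageI)
    then show ?thesis by simp
  qed
  moreover have "B \<ge> 0" using calculation[of 0] by simp
  ultimately show ?thesis using that by blast
qed

lemma circle_integral_deriv:
  fixes u :: "real \<Rightarrow> real"
  assumes u: "u \<in> circle_smooth L" and L: "L > 0"
  shows "integral {0..L} (deriv u) = 0"
proof -
  have "(deriv u has_integral u L - u 0) {0..L}"
    by (rule fundamental_theorem_of_calculus)
      (use L circle_smooth_has_derivative[OF u] in
        \<open>auto simp: has_real_derivative_iff_has_vector_derivative[symmetric] intro: has_field_derivative_at_within\<close>)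
  moreover have "u L = u 0" using circle_smooth_periodic_int[OF u, of 0 1] by simp
  ultimately show ?thesis by (simp add: integral_unique)
qed

lemma circle_smooth_exp:
  fixes u :: "real \<Rightarrow> real"
  shows "u \<in> circle_smooth L \<Longrightarrow> (\<lambda>x. exp (u x)) \<in> circle_smooth L"
  by (simp add: circle_smooth_def smooth_exp)

lemmas circle_smooth_intros =
  circle_smooth_const circle_smooth_add circle_smooth_diff circle_smooth_mult circle_smooth_deriv

lemma circle_smooth_integrable:
  fixes u :: "real \<Rightarrow> real"
  shows "u \<in> circle_smooth L \<Longrightarrow> u integrable_on {0..L}"
  by (intro integrable_continuous_real circle_smooth_continuous)

lemma circle_integral_add:
  fixes u v :: "real \<Rightarrow> real"
  shows "u \<in> circle_smooth L \<Longrightarrow> v \<in> circle_smooth L \<Longrightarrow>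
    integral {0..L} (\<lambda>x. u x + v x) = integral {0..L} u + integral {0..L} v"
  by (intro integral_add circle_smooth_integrable)

lemma circle_integral_diff:
  fixes u v :: "real \<Rightarrow> real"
  shows "u \<in> circle_smooth L \<Longrightarrow> v \<in> circle_smooth L \<Longrightarrow>
    integral {0..L} (\<lambda>x. u x - v x) = integral {0..L} u - integral {0..L} v"
  by (intro integral_diff circle_smooth_integrable)

lemmas circle_integral_linear = circle_integral_add circle_integral_diff integral_mult_right

text \<open>
  There are no boundary terms on a closed curve.
\<close>

lemma circle_integral_by_parts:
  fixes u v :: "real \<Rightarrow> real"
  assumes u: "u \<in> circle_smooth L" and v: "v \<in> circle_smooth L" and L: "L > 0"
  shows "integral {0..L} (\<lambda>x. u x * deriv v x) = - integral {0..L} (\<lambda>x. deriv u x * v x)"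
proof -
  have "deriv (\<lambda>x. u x * v x) x = u x * deriv v x + deriv u x * v x" for x
    using DERIV_mult[OF circle_smooth_has_derivative[OF u] circle_smooth_has_derivative[OF v], of x]
    by (simp add: DERIV_imp_deriv algebra_simps)
  then have "integral {0..L} (\<lambda>x. u x * deriv v x + deriv u x * v x) = 0"
    using circle_integral_deriv[OF circle_smooth_mult[OF u v] L] by presburger
  then show ?thesis
    by (subst (asm) circle_integral_add) (use u v in \<open>auto intro!: circle_smooth_intros\<close>)
qed

lemma circle_integral_square_eq_0:
  fixes u :: "real \<Rightarrow> real"
  assumes u: "u \<in> circle_smooth L" and L: "L > 0" and zero: "integral {0..L} (\<lambda>x. u x * u x) = 0"
  shows "u = (\<lambda>_. 0)"
proof
  fix x
  obtain y where y: "y \<in> {0..L}" "u y = u x" using circle_smooth_representative[OF u L] .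
  have "continuous_on {0..L} (\<lambda>x. u x * u x)"
    by (intro continuous_intros circle_smooth_continuous[OF u])
  from integral_eq_0_iff[OF this L] zero y show "u x = 0" by auto
qed

lemma circle_integral_abs_le:
  fixes u :: "real \<Rightarrow> real"
  assumes L: "L > 0" and u: "u \<in> circle_smooth L" and B: "\<And>x. \<bar>u x\<bar> \<le> B"
  shows "\<bar>integral {0..L} u\<bar> \<le> L * B"
  using integral_bound[of 0 L u B] circle_smooth_continuous[OF u] B L by (simp add: mult.commute)

lemma sup_norm_square_le_iff:
  assumes m: "m \<in> circle_smooth L" and L: "L > 0"
  shows "(sup_norm m)\<^sup>2 \<le> X \<longleftrightarrow> (\<forall>\<theta>. (m \<theta>)\<^sup>2 \<le> X)"
proof
  obtain B where B: "\<And>x. \<bar>m x\<bar> \<le> B" using circle_smooth_bounded[OF m L] by metis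
  have bdd: "bdd_above (range (\<lambda>x. \<bar>m x\<bar>))" using B by (intro bdd_aboveI2)
  have le: "\<bar>m \<theta>\<bar> \<le> sup_norm m" for \<theta>
    unfolding sup_norm_def by (rule cSUP_upper[OF UNIV_I bdd])
  show "\<forall>\<theta>. (m \<theta>)\<^sup>2 \<le> X" if "(sup_norm m)\<^sup>2 \<le> X"
  proof
    fix \<theta>
    have "\<bar>m \<theta>\<bar>\<^sup>2 \<le> (sup_norm m)\<^sup>2" using le by (rule power_mono) simp
    then show "(m \<theta>)\<^sup>2 \<le> X" using that by simp
  qed
  show "(sup_norm m)\<^sup>2 \<le> X" if *: "\<forall>\<theta>. (m \<theta>)\<^sup>2 \<le> X"
  proof -
    have X: "X \<ge> 0" using * zero_le_power2 order_trans by blast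
    have "sup_norm m \<le> sqrt X"
      unfolding sup_norm_def by (rule cSUP_least) (use * real_le_rsqrt in auto)
    moreover have "0 \<le> sup_norm m" using le[of 0] by simp
    ultimately have "(sup_norm m)\<^sup>2 \<le> (sqrt X)\<^sup>2" by (rule power_mono)
    then show ?thesis using X by simp
  qed
qed

text \<open>
  For a curve of unit speed the curvature is the polynomial expression \<open>Re c' Im c'' - Im c' Re c''\<close>.
\<close>

lemma curvature_circle_smooth:
  assumes c: "c \<in> circle_smooth L" and arc: "arclength_param c"
  shows "curvature c \<in> circle_smooth L"
proof -
  have v: "velocity c \<in> circle_smooth L" using circle_smooth_vector_derivative[OF c] .
  have a: "velocity (velocity c) \<in> circle_smooth L" using circle_smooth_vector_derivative[OF v] .
  have part: "(\<lambda>x. Re (z x)) \<in> circle_smooth L \<and> (\<lambda>x. Im (z x)) \<in> circle_smooth L"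
    if "z \<in> circle_smooth L" for z
    using that by (auto simp: circle_smooth_def intro: smooth_bounded_linear bounded_linear_Re bounded_linear_Im)
  have "curvature c = (\<lambda>x. Re (velocity c x) * Im (velocity (velocity c) x) -
      Im (velocity c x) * Re (velocity (velocity c) x))"
  proof
    fix x
    let ?v = "velocity c x" and ?k = "curvature c x"
    have "(Re ?v)\<^sup>2 + (Im ?v)\<^sup>2 = 1"
      using norm_velocity_arclength[OF c arc, of x] cmod_power2[of ?v] by simp
    then have "?k = ?k * ((Re ?v)\<^sup>2 + (Im ?v)\<^sup>2)" by simp
    also have "\<dots> = Re ?v * Im (of_real ?k * (\<i> * ?v)) - Im ?v * Re (of_real ?k * (\<i> * ?v))"
      by (simp add: power2_eq_square algebra_simps)
    finally show "?k = Re ?v * Im (velocity (velocity c) x) - Im ?v * Re (velocity (velocity c) x)"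
      unfolding curvature_arclength[OF c arc] unit_normal_arclength[OF c arc] .
  qed
  also have "\<dots> \<in> circle_smooth L"
    using part[OF v] part[OF a] by (intro circle_smooth_diff circle_smooth_mult) auto
  finally show ?thesis .
qed

section \<open>First and second variation of length and weighted length\<close>

text \<open>
  Along the curve \<open>c + f n\<^sub>c\<close> the velocity has the components \<open>w = 1 - f\<kappa>\<close> and \<open>p = f'\<close> in the
  moving frame of \<open>c\<close>. Expressing all integrands through \<open>w\<close>, \<open>p\<close> and the inverse speed makes their
  derivatives polynomial in these three quantities and the directions.
\<close>

definition inv_speed :: "real \<Rightarrow> real \<Rightarrow> real" where
  "inv_speed w p = 1 / sqrt (w\<^sup>2 + p\<^sup>2)"

lemma DERIV_speed:
  assumes w: "(w has_real_derivative a) (at t)" and p: "(p has_real_derivative b) (at t)"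
    and pos: "w t > 0"
  shows "((\<lambda>t. sqrt ((w t)\<^sup>2 + (p t)\<^sup>2)) has_real_derivative
    (w t * a + p t * b) * inv_speed (w t) (p t)) (at t)"
proof -
  define X where "X = w t * a + p t * b"
  have N: "(w t)\<^sup>2 + (p t)\<^sup>2 > 0" using pos by (simp add: add_pos_nonneg)
  have "((\<lambda>t. (w t)\<^sup>2 + (p t)\<^sup>2) has_real_derivative 2 * X) (at t)"
    unfolding X_def by (rule derivative_eq_intros w p refl | simp)+
  then have "((\<lambda>t. sqrt ((w t)\<^sup>2 + (p t)\<^sup>2)) has_real_derivative
     inverse (sqrt ((w t)\<^sup>2 + (p t)\<^sup>2)) / 2 * (2 * X)) (at t)"
    by (rule DERIV_chain2[where f = sqrt and g = "\<lambda>t. (w t)\<^sup>2 + (p t)\<^sup>2", OF DERIV_real_sqrt[OF N]])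
  then show ?thesis
    unfolding X_def[symmetric] by (rule DERIV_cong) (simp add: inv_speed_def inverse_eq_divide)
qed

lemma DERIV_inv_speed:
  assumes w: "(w has_real_derivative a) (at t)" and p: "(p has_real_derivative b) (at t)"
    and pos: "w t > 0"
  shows "((\<lambda>t. inv_speed (w t) (p t)) has_real_derivative
    - (w t * a + p t * b) * inv_speed (w t) (p t) ^ 3) (at t)"
proof -
  have "(w t)\<^sup>2 + (p t)\<^sup>2 > 0" using pos by (simp add: add_pos_nonneg)
  then have "sqrt ((w t)\<^sup>2 + (p t)\<^sup>2) \<noteq> 0" by (metis less_irrefl real_sqrt_eq_zero_cancel_iff)
  from DERIV_inverse'[OF DERIV_speed[OF assms] this]
  show ?thesis
    by (simp add: inv_speed_def inverse_eq_divide power3_eq_cube minus_divide_left mult_ac)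
qed

lemma continuous_on_inv_speed:
  assumes "continuous_on A w" "continuous_on A p" "\<And>x. x \<in> A \<Longrightarrow> w x > 0"
  shows "continuous_on A (\<lambda>x. inv_speed (w x) (p x))"
proof -
  have "(w x)\<^sup>2 + (p x)\<^sup>2 > 0" if "x \<in> A" for x
    using assms(3)[OF that] by (simp add: add_pos_nonneg)
  then show ?thesis
    unfolding inv_speed_def using assms(1,2) by (intro continuous_intros) fastforce+
qed

text \<open>
  Compactness of the circle makes the range of admissible \<open>t\<close> uniform in \<open>\<theta>\<close>: it suffices that
  \<open>\<bar>t\<bar>\<close> is below the inverse of an upper bound of \<open>\<bar>u\<bar> / w\<close>.
\<close>

lemma positive_perturbation:
  fixes w u :: "real \<Rightarrow> real"
  assumes w: "continuous_on {0..L} w" and u: "continuous_on {0..L} u"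
    and pos: "\<And>\<theta>. \<theta> \<in> {0..L} \<Longrightarrow> w \<theta> > 0"
  obtains \<delta> where "\<delta> > 0" "\<And>t \<theta>. \<bar>t\<bar> < \<delta> \<Longrightarrow> \<theta> \<in> {0..L} \<Longrightarrow> w \<theta> + t * u \<theta> > 0"
proof -
  have "continuous_on {0..L} (\<lambda>\<theta>. \<bar>u \<theta>\<bar> / w \<theta>)"
    using pos by (intro continuous_intros w u) fastforce
  then have "compact ((\<lambda>\<theta>. \<bar>u \<theta>\<bar> / w \<theta>) ` {0..L})"
    by (intro compact_continuous_image) auto
  then obtain B where B: "B > 0" "\<forall>y\<in>(\<lambda>\<theta>. \<bar>u \<theta>\<bar> / w \<theta>) ` {0..L}. norm y \<le> B"
    using compact_imp_bounded bounded_pos by metis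
  have "w \<theta> + t * u \<theta> > 0" if t: "\<bar>t\<bar> < 1 / B" and \<theta>: "\<theta> \<in> {0..L}" for t \<theta>
  proof -
    have wpos: "w \<theta> > 0" using pos[OF \<theta>] .
    have "norm (\<bar>u \<theta>\<bar> / w \<theta>) \<le> B" using B(2) \<theta> by blast
    then have "\<bar>u \<theta>\<bar> / w \<theta> \<le> B" using wpos by simp
    then have "\<bar>u \<theta>\<bar> \<le> B * w \<theta>" using wpos by (simp add: pos_divide_le_eq)
    then have "\<bar>t * u \<theta>\<bar> \<le> \<bar>t\<bar> * (B * w \<theta>)" by (simp add: abs_mult mult_left_mono)
    also have "\<dots> < (1 / B) * (B * w \<theta>)"
      using t B(1) wpos by (intro mult_strict_right_mono) auto
    finally show ?thesis using B(1) by simp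
  qed
  then show ?thesis using that[of "1 / B"] B(1) by simp
qed

lemma DERIV_integral_parameter:
  fixes F F' :: "real \<Rightarrow> real \<Rightarrow> real"
  assumes \<delta>: "\<delta> > 0"
    and der: "\<And>t \<theta>. \<bar>t\<bar> < \<delta> \<Longrightarrow> \<theta> \<in> {0..L} \<Longrightarrow> ((\<lambda>t. F t \<theta>) has_real_derivative F' t \<theta>) (at t)"
    and contF: "continuous_on ({-\<delta><..<\<delta>} \<times> {0..L}) (\<lambda>x. F (fst x) (snd x))"
    and contF': "continuous_on ({-\<delta><..<\<delta>} \<times> {0..L}) (\<lambda>x. F' (fst x) (snd x))"
  shows "((\<lambda>t. integral {0..L} (F t)) has_real_derivative integral {0..L} (F' 0)) (at 0)"
proof -
  have "((\<lambda>t. integral (cbox 0 L) (F t)) has_real_derivative integral (cbox 0 L) (F' 0))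
      (at 0 within {-\<delta><..<\<delta>})"
  proof (rule leibniz_rule_field_derivative)
    show "((\<lambda>t. F t \<theta>) has_real_derivative F' t \<theta>) (at t within {-\<delta><..<\<delta>})"
      if "t \<in> {-\<delta><..<\<delta>}" "\<theta> \<in> cbox 0 L" for t \<theta>
      using der[of t \<theta>] that by (auto intro: has_field_derivative_at_within)
    show "F t integrable_on cbox 0 L" if "t \<in> {-\<delta><..<\<delta>}" for t
    proof -
      have "continuous_on {0..L} (\<lambda>\<theta>. F (fst (t, \<theta>)) (snd (t, \<theta>)))"
        by (rule continuous_on_compose2[OF contF, where f = "\<lambda>\<theta>. (t, \<theta>)"])
          (use that in \<open>auto intro!: continuous_intros\<close>)
      then show ?thesis by (simp add: integrable_continuous_real)
    qed
    show "continuous_on ({-\<delta><..<\<delta>} \<times> cbox 0 L) (\<lambda>(t, \<theta>). F' t \<theta>)"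
      using contF' by (simp add: split_beta')
  qed (use \<delta> in auto)
  moreover have "at 0 within {-\<delta><..<\<delta>} = at (0::real)"
    using \<delta> by (intro at_within_open) auto
  ultimately show ?thesis by simp
qed

lemma continuous_on_snd_compose:
  fixes w :: "real \<Rightarrow> real"
  assumes "continuous_on {0..L} w"
  shows "continuous_on (U \<times> {0..L}) (\<lambda>x. w (snd x))"
  by (rule continuous_on_compose2[OF assms]) (auto intro: continuous_intros)

definition arc_len :: "real \<Rightarrow> (real \<Rightarrow> real) \<Rightarrow> (real \<Rightarrow> real) \<Rightarrow> real" where
  "arc_len L w p = integral {0..L} (\<lambda>\<theta>. sqrt ((w \<theta>)\<^sup>2 + (p \<theta>)\<^sup>2))"

text \<open>
  The metric paired on two fields is \<open>\<phi>\<close> of the length times this integral, where \<open>g\<close> is the product of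
  the two fields.
\<close>

definition weighted_len :: "real \<Rightarrow> (real \<Rightarrow> real) \<Rightarrow> (real \<Rightarrow> real) \<Rightarrow> (real \<Rightarrow> real) \<Rightarrow> real" where
  "weighted_len L g w p = integral {0..L} (\<lambda>\<theta>. (w \<theta>)\<^sup>2 * g \<theta> * inv_speed (w \<theta>) (p \<theta>))"

definition arc_len_variation ::
  "real \<Rightarrow> (real \<Rightarrow> real) \<Rightarrow> (real \<Rightarrow> real) \<Rightarrow> (real \<Rightarrow> real) \<Rightarrow> (real \<Rightarrow> real) \<Rightarrow> real" where
  "arc_len_variation L w p u v =
     integral {0..L} (\<lambda>\<theta>. (w \<theta> * u \<theta> + p \<theta> * v \<theta>) * inv_speed (w \<theta>) (p \<theta>))"

definition weighted_len_variation ::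
  "real \<Rightarrow> (real \<Rightarrow> real) \<Rightarrow> (real \<Rightarrow> real) \<Rightarrow> (real \<Rightarrow> real) \<Rightarrow> (real \<Rightarrow> real) \<Rightarrow> (real \<Rightarrow> real) \<Rightarrow> real" where
  "weighted_len_variation L g w p u v =
     integral {0..L} (\<lambda>\<theta>. (2 * w \<theta> * u \<theta> * inv_speed (w \<theta>) (p \<theta>)
       - (w \<theta>)\<^sup>2 * (w \<theta> * u \<theta> + p \<theta> * v \<theta>) * inv_speed (w \<theta>) (p \<theta>) ^ 3) * g \<theta>)"

context
  fixes L :: real and w p u v :: "real \<Rightarrow> real"
  assumes w: "continuous_on {0..L} w" and p: "continuous_on {0..L} p"
    and u: "continuous_on {0..L} u" and v: "continuous_on {0..L} v"
    and pos: "\<And>\<theta>. \<theta> \<in> {0..L} \<Longrightarrow> w \<theta> > 0"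
begin

lemma DERIV_arc_len:
  "((\<lambda>t. arc_len L (\<lambda>\<theta>. w \<theta> + t * u \<theta>) (\<lambda>\<theta>. p \<theta> + t * v \<theta>)) has_real_derivative
      arc_len_variation L w p u v) (at 0)"
proof -
  obtain \<delta> where \<delta>: "\<delta> > 0"
    and pos': "\<And>t \<theta>. \<bar>t\<bar> < \<delta> \<Longrightarrow> \<theta> \<in> {0..L} \<Longrightarrow> w \<theta> + t * u \<theta> > 0"
    using positive_perturbation[OF w u pos] by metis
  let ?W = "\<lambda>t \<theta>. w \<theta> + t * u \<theta>" and ?P = "\<lambda>t \<theta>. p \<theta> + t * v \<theta>"
  note c = continuous_on_snd_compose[OF w] continuous_on_snd_compose[OF p]
    continuous_on_snd_compose[OF u] continuous_on_snd_compose[OF v]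
  have "((\<lambda>t. integral {0..L} (\<lambda>\<theta>. sqrt ((?W t \<theta>)\<^sup>2 + (?P t \<theta>)\<^sup>2))) has_real_derivative
      integral {0..L} (\<lambda>\<theta>. (?W 0 \<theta> * u \<theta> + ?P 0 \<theta> * v \<theta>) * inv_speed (?W 0 \<theta>) (?P 0 \<theta>))) (at 0)"
  proof (rule DERIV_integral_parameter[OF \<delta>])
    show "((\<lambda>t. sqrt ((?W t \<theta>)\<^sup>2 + (?P t \<theta>)\<^sup>2)) has_real_derivative
        (?W t \<theta> * u \<theta> + ?P t \<theta> * v \<theta>) * inv_speed (?W t \<theta>) (?P t \<theta>)) (at t)"
      if "\<bar>t\<bar> < \<delta>" "\<theta> \<in> {0..L}" for t \<theta>
      by (rule DERIV_speed) (auto intro!: derivative_eq_intros pos' that)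
  qed (intro continuous_intros c continuous_on_inv_speed; use pos' in auto)+
  then show ?thesis unfolding arc_len_def arc_len_variation_def by simp
qed

lemma DERIV_weighted_len:
  assumes g: "continuous_on {0..L} g"
  shows "((\<lambda>t. weighted_len L g (\<lambda>\<theta>. w \<theta> + t * u \<theta>) (\<lambda>\<theta>. p \<theta> + t * v \<theta>)) has_real_derivative
      weighted_len_variation L g w p u v) (at 0)"
proof -
  obtain \<delta> where \<delta>: "\<delta> > 0"
    and pos': "\<And>t \<theta>. \<bar>t\<bar> < \<delta> \<Longrightarrow> \<theta> \<in> {0..L} \<Longrightarrow> w \<theta> + t * u \<theta> > 0"
    using positive_perturbation[OF w u pos] by metis
  let ?W = "\<lambda>t \<theta>. w \<theta> + t * u \<theta>" and ?P = "\<lambda>t \<theta>. p \<theta> + t * v \<theta>"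
  let ?q = "\<lambda>t \<theta>. inv_speed (?W t \<theta>) (?P t \<theta>)"
  note c = continuous_on_snd_compose[OF w] continuous_on_snd_compose[OF p]
    continuous_on_snd_compose[OF u] continuous_on_snd_compose[OF v] continuous_on_snd_compose[OF g]
  have "((\<lambda>t. integral {0..L} (\<lambda>\<theta>. (?W t \<theta>)\<^sup>2 * g \<theta> * ?q t \<theta>)) has_real_derivative
      integral {0..L} (\<lambda>\<theta>. (2 * ?W 0 \<theta> * u \<theta> * ?q 0 \<theta>
       - (?W 0 \<theta>)\<^sup>2 * (?W 0 \<theta> * u \<theta> + ?P 0 \<theta> * v \<theta>) * ?q 0 \<theta> ^ 3) * g \<theta>)) (at 0)"
  proof (rule DERIV_integral_parameter[OF \<delta>])
    show "((\<lambda>t. (?W t \<theta>)\<^sup>2 * g \<theta> * ?q t \<theta>) has_real_derivative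
        (2 * ?W t \<theta> * u \<theta> * ?q t \<theta>
       - (?W t \<theta>)\<^sup>2 * (?W t \<theta> * u \<theta> + ?P t \<theta> * v \<theta>) * ?q t \<theta> ^ 3) * g \<theta>) (at t)"
      if "\<bar>t\<bar> < \<delta>" "\<theta> \<in> {0..L}" for t \<theta>
    proof -
      have W: "((\<lambda>t. ?W t \<theta>) has_real_derivative u \<theta>) (at t)"
        and P: "((\<lambda>t. ?P t \<theta>) has_real_derivative v \<theta>) (at t)"
        by (auto intro!: derivative_eq_intros)
      have "((\<lambda>t. (?W t \<theta>)\<^sup>2 * g \<theta>) has_real_derivative 2 * ?W t \<theta> * u \<theta> * g \<theta>) (at t)"
        by (auto intro!: derivative_eq_intros simp: power2_eq_square algebra_simps)
      from DERIV_mult[OF this DERIV_inv_speed[OF W P pos'[OF that]]]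
      show ?thesis by (simp add: algebra_simps)
    qed
  qed (intro continuous_intros c continuous_on_inv_speed; use pos' in auto)+
  then show ?thesis unfolding weighted_len_def weighted_len_variation_def by simp
qed

end

context
  fixes L :: real and a b u v :: "real \<Rightarrow> real"
  assumes a: "continuous_on {0..L} a" and b: "continuous_on {0..L} b"
    and u: "continuous_on {0..L} u" and v: "continuous_on {0..L} v"
begin

text \<open>
  The second variation, at the curve itself, where \<open>w = 1\<close> and \<open>p = 0\<close>. For \<open>p = 0\<close> both
  densities \<open>sqrt (w\<^sup>2 + p\<^sup>2)\<close> and \<open>w\<^sup>2 / sqrt (w\<^sup>2 + p\<^sup>2)\<close> reduce to \<open>w\<close>, which is linear; so
  the terms with \<open>a\<close> and \<open>u\<close> cancel and only the product \<open>b v\<close> survives, with opposite signs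
  for the two densities.
\<close>

lemma DERIV_arc_len_variation:
  "((\<lambda>s. arc_len_variation L (\<lambda>\<theta>. 1 + s * a \<theta>) (\<lambda>\<theta>. s * b \<theta>) u v) has_real_derivative
      integral {0..L} (\<lambda>\<theta>. b \<theta> * v \<theta>)) (at 0)"
proof -
  obtain \<delta> where \<delta>: "\<delta> > 0"
    and pos': "\<And>s \<theta>. \<bar>s\<bar> < \<delta> \<Longrightarrow> \<theta> \<in> {0..L} \<Longrightarrow> 1 + s * a \<theta> > 0"
    using positive_perturbation[of L "\<lambda>_. 1", OF continuous_on_const a] by auto
  let ?W = "\<lambda>s \<theta>. 1 + s * a \<theta>" and ?P = "\<lambda>s \<theta>. s * b \<theta>"
  let ?q = "\<lambda>s \<theta>. inv_speed (?W s \<theta>) (?P s \<theta>)"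
  note c = continuous_on_snd_compose[OF a] continuous_on_snd_compose[OF b]
    continuous_on_snd_compose[OF u] continuous_on_snd_compose[OF v]
  have "((\<lambda>s. integral {0..L} (\<lambda>\<theta>. (?W s \<theta> * u \<theta> + ?P s \<theta> * v \<theta>) * ?q s \<theta>)) has_real_derivative
      integral {0..L} (\<lambda>\<theta>. (a \<theta> * u \<theta> + b \<theta> * v \<theta>) * ?q 0 \<theta>
        - (?W 0 \<theta> * u \<theta> + ?P 0 \<theta> * v \<theta>) * (?W 0 \<theta> * a \<theta> + ?P 0 \<theta> * b \<theta>) * ?q 0 \<theta> ^ 3)) (at 0)"
  proof (rule DERIV_integral_parameter[OF \<delta>])
    show "((\<lambda>s. (?W s \<theta> * u \<theta> + ?P s \<theta> * v \<theta>) * ?q s \<theta>) has_real_derivative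
        (a \<theta> * u \<theta> + b \<theta> * v \<theta>) * ?q s \<theta>
        - (?W s \<theta> * u \<theta> + ?P s \<theta> * v \<theta>) * (?W s \<theta> * a \<theta> + ?P s \<theta> * b \<theta>) * ?q s \<theta> ^ 3) (at s)"
      if "\<bar>s\<bar> < \<delta>" "\<theta> \<in> {0..L}" for s \<theta>
    proof -
      have W: "((\<lambda>s. ?W s \<theta>) has_real_derivative a \<theta>) (at s)"
        and P: "((\<lambda>s. ?P s \<theta>) has_real_derivative b \<theta>) (at s)"
        by (auto intro!: derivative_eq_intros)
      have "((\<lambda>s. ?W s \<theta> * u \<theta> + ?P s \<theta> * v \<theta>) has_real_derivative a \<theta> * u \<theta> + b \<theta> * v \<theta>) (at s)"
        by (auto intro!: derivative_eq_intros)
      from DERIV_mult[OF this DERIV_inv_speed[OF W P pos'[OF that]]]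
      show ?thesis by (simp add: algebra_simps)
    qed
  qed (intro continuous_intros c continuous_on_inv_speed; use pos' in auto)+
  then show ?thesis
    unfolding arc_len_variation_def by (simp add: inv_speed_def algebra_simps)
qed

lemma DERIV_weighted_len_variation:
  assumes g: "continuous_on {0..L} g"
  shows "((\<lambda>s. weighted_len_variation L g (\<lambda>\<theta>. 1 + s * a \<theta>) (\<lambda>\<theta>. s * b \<theta>) u v) has_real_derivative
      - integral {0..L} (\<lambda>\<theta>. b \<theta> * v \<theta> * g \<theta>)) (at 0)"
proof -
  obtain \<delta> where \<delta>: "\<delta> > 0"
    and pos': "\<And>s \<theta>. \<bar>s\<bar> < \<delta> \<Longrightarrow> \<theta> \<in> {0..L} \<Longrightarrow> 1 + s * a \<theta> > 0"
    using positive_perturbation[of L "\<lambda>_. 1", OF continuous_on_const a] by auto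
  let ?W = "\<lambda>s \<theta>. 1 + s * a \<theta>" and ?P = "\<lambda>s \<theta>. s * b \<theta>"
  let ?q = "\<lambda>s \<theta>. inv_speed (?W s \<theta>) (?P s \<theta>)"
  let ?A = "\<lambda>s \<theta>. ?W s \<theta> * u \<theta> + ?P s \<theta> * v \<theta>" and ?B = "\<lambda>s \<theta>. ?W s \<theta> * a \<theta> + ?P s \<theta> * b \<theta>"
  let ?D = "\<lambda>s \<theta>. (2 * (a \<theta> * u \<theta> * ?q s \<theta> - ?W s \<theta> * u \<theta> * ?B s \<theta> * ?q s \<theta> ^ 3)
    - (2 * ?W s \<theta> * a \<theta> * ?A s \<theta> + (?W s \<theta>)\<^sup>2 * (a \<theta> * u \<theta> + b \<theta> * v \<theta>)) * ?q s \<theta> ^ 3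
    + 3 * (?W s \<theta>)\<^sup>2 * ?A s \<theta> * ?B s \<theta> * ?q s \<theta> ^ 5) * g \<theta>"
  note c = continuous_on_snd_compose[OF a] continuous_on_snd_compose[OF b]
    continuous_on_snd_compose[OF u] continuous_on_snd_compose[OF v] continuous_on_snd_compose[OF g]
  have "((\<lambda>s. integral {0..L} (\<lambda>\<theta>. (2 * ?W s \<theta> * u \<theta> * ?q s \<theta> - (?W s \<theta>)\<^sup>2 * ?A s \<theta> * ?q s \<theta> ^ 3) * g \<theta>))
      has_real_derivative integral {0..L} (?D 0)) (at 0)"
  proof (rule DERIV_integral_parameter[OF \<delta>])
    show "((\<lambda>s. (2 * ?W s \<theta> * u \<theta> * ?q s \<theta> - (?W s \<theta>)\<^sup>2 * ?A s \<theta> * ?q s \<theta> ^ 3) * g \<theta>)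
        has_real_derivative ?D s \<theta>) (at s)"
      if "\<bar>s\<bar> < \<delta>" "\<theta> \<in> {0..L}" for s \<theta>
    proof -
      have W: "((\<lambda>s. ?W s \<theta>) has_real_derivative a \<theta>) (at s)"
        and P: "((\<lambda>s. ?P s \<theta>) has_real_derivative b \<theta>) (at s)"
        by (auto intro!: derivative_eq_intros)
      note q = DERIV_inv_speed[OF W P pos'[OF that]]
      have W2: "((\<lambda>s. 2 * ?W s \<theta> * u \<theta>) has_real_derivative 2 * a \<theta> * u \<theta>) (at s)"
        and WA: "((\<lambda>s. (?W s \<theta>)\<^sup>2 * ?A s \<theta>) has_real_derivative
          2 * ?W s \<theta> * a \<theta> * ?A s \<theta> + (?W s \<theta>)\<^sup>2 * (a \<theta> * u \<theta> + b \<theta> * v \<theta>)) (at s)"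
        by (auto intro!: derivative_eq_intros simp: power2_eq_square algebra_simps)
      have "?q s \<theta> ^ 5 = ?q s \<theta> ^ 2 * ?q s \<theta> ^ 3" by (simp flip: power_add)
      then show ?thesis
        by (intro DERIV_cong[OF DERIV_cmult_right[OF DERIV_diff[OF DERIV_mult[OF W2 q]
              DERIV_mult[OF WA DERIV_power[OF q, of 3]]]]])
          (simp add: algebra_simps)
    qed
  qed (intro continuous_intros c continuous_on_inv_speed; use pos' in auto)+
  moreover have "integral {0..L} (?D 0) = - integral {0..L} (\<lambda>\<theta>. b \<theta> * v \<theta> * g \<theta>)"
    unfolding integral_neg[symmetric] by (simp add: inv_speed_def algebra_simps)
  ultimately show ?thesis
    unfolding weighted_len_variation_def by simp
qed

end

section \<open>The metric in the chart and its first two derivatives\<close>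

locale arclength_curve =
  fixes \<phi> :: "real \<Rightarrow> real" and L :: real and c :: "real \<Rightarrow> complex"
  assumes phi_smooth: "smooth_on {0<..} \<phi>"
    and phi_pos: "\<And>x. x > 0 \<Longrightarrow> \<phi> x > 0"
    and length_pos: "L > 0"
    and curve_smooth: "c \<in> circle_smooth L"
    and arclength: "arclength_param c"
begin

abbreviation kap :: "real \<Rightarrow> real" where "kap \<equiv> curvature c"
abbreviation G where "G \<equiv> chart_metric \<phi> L c"
abbreviation I :: "(real \<Rightarrow> real) \<Rightarrow> real" where "I u \<equiv> integral {0..L} u"

lemma kap_smooth: "kap \<in> circle_smooth L"
  by (rule curvature_circle_smooth[OF curve_smooth arclength])

lemma phi_L_pos: "\<phi> L > 0"
  using phi_pos length_pos .

lemma phi_derivative: "x > 0 \<Longrightarrow> (\<phi> has_real_derivative deriv \<phi> x) (at x)"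
  using smooth_on_has_real_derivative[OF phi_smooth] by simp

lemma phi_second_derivative: "(deriv \<phi> has_real_derivative deriv (deriv \<phi>) L) (at L)"
  using smooth_on_has_real_derivative[OF smooth_on_vector_derivative[OF phi_smooth], of L] length_pos
  by (simp add: deriv_eq_vector_derivative)

lemma metric_eq:
  assumes f: "f \<in> circle_smooth L"
  shows "G f h k = \<phi> (arc_len L (\<lambda>\<theta>. 1 - f \<theta> * kap \<theta>) (deriv f)) *
    weighted_len L (\<lambda>\<theta>. h \<theta> * k \<theta>) (\<lambda>\<theta>. 1 - f \<theta> * kap \<theta>) (deriv f)"
  unfolding chart_metric_formula[OF curve_smooth arclength f] arc_len_def weighted_len_def inv_speed_def
  by (simp add: mult.assoc)

lemma metric_at_zero: "G (\<lambda>_. 0) h k = \<phi> L * I (\<lambda>\<theta>. h \<theta> * k \<theta>)"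
  using length_pos
  by (simp add: metric_eq[OF circle_smooth_const] arc_len_def weighted_len_def inv_speed_def)

lemma arc_len_pos:
  assumes w: "continuous_on {0..L} w" and p: "continuous_on {0..L} p"
    and pos: "\<And>\<theta>. \<theta> \<in> {0..L} \<Longrightarrow> w \<theta> > 0"
  shows "arc_len L w p > 0"
proof -
  let ?s = "\<lambda>\<theta>. sqrt ((w \<theta>)\<^sup>2 + (p \<theta>)\<^sup>2)"
  have s: "continuous_on {0..L} ?s" by (intro continuous_intros w p)
  have "?s 0 \<noteq> 0" using pos[of 0] length_pos by auto
  then have "I ?s \<noteq> 0"
    using integral_eq_0_iff[OF s length_pos] length_pos by force
  moreover have "I ?s \<ge> 0"
    using s by (intro integral_nonneg integrable_continuous_real) auto
  ultimately show ?thesis unfolding arc_len_def by simp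
qed

lemma deriv_along_line:
  fixes f j :: "real \<Rightarrow> real"
  assumes "f \<in> circle_smooth L" "j \<in> circle_smooth L"
  shows "deriv (\<lambda>\<theta>. f \<theta> + t * j \<theta>) = (\<lambda>\<theta>. deriv f \<theta> + t * deriv j \<theta>)"
  by (rule ext DERIV_imp_deriv DERIV_add DERIV_cmult circle_smooth_has_derivative assms)+

lemma DERIV_metric:
  assumes f: "f \<in> circle_smooth L" and j: "j \<in> circle_smooth L"
    and x: "x \<in> circle_smooth L" and y: "y \<in> circle_smooth L"
    and pos: "\<And>\<theta>. \<theta> \<in> {0..L} \<Longrightarrow> 1 - f \<theta> * kap \<theta> > 0"
  shows "((\<lambda>t. G (\<lambda>\<theta>. f \<theta> + t * j \<theta>) x y) has_real_derivative
    deriv \<phi> (arc_len L (\<lambda>\<theta>. 1 - f \<theta> * kap \<theta>) (deriv f))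
      * arc_len_variation L (\<lambda>\<theta>. 1 - f \<theta> * kap \<theta>) (deriv f) (\<lambda>\<theta>. - (j \<theta> * kap \<theta>)) (deriv j)
      * weighted_len L (\<lambda>\<theta>. x \<theta> * y \<theta>) (\<lambda>\<theta>. 1 - f \<theta> * kap \<theta>) (deriv f)
    + weighted_len_variation L (\<lambda>\<theta>. x \<theta> * y \<theta>) (\<lambda>\<theta>. 1 - f \<theta> * kap \<theta>) (deriv f)
        (\<lambda>\<theta>. - (j \<theta> * kap \<theta>)) (deriv j)
      * \<phi> (arc_len L (\<lambda>\<theta>. 1 - f \<theta> * kap \<theta>) (deriv f))) (at 0)"
proof -
  let ?w = "\<lambda>\<theta>. 1 - f \<theta> * kap \<theta>" and ?u = "\<lambda>\<theta>. - (j \<theta> * kap \<theta>)"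
  have w: "continuous_on {0..L} ?w" and u: "continuous_on {0..L} ?u"
    and g: "continuous_on {0..L} (\<lambda>\<theta>. x \<theta> * y \<theta>)"
    by (intro continuous_intros f[THEN circle_smooth_continuous] j[THEN circle_smooth_continuous]
      x[THEN circle_smooth_continuous] y[THEN circle_smooth_continuous] kap_smooth[THEN circle_smooth_continuous])+
  note f' = circle_smooth_continuous[OF circle_smooth_deriv[OF f]]
    and j' = circle_smooth_continuous[OF circle_smooth_deriv[OF j]]
  have line: "(\<lambda>\<theta>. f \<theta> + t * j \<theta>) \<in> circle_smooth L" for t
    by (intro circle_smooth_add circle_smooth_mult circle_smooth_const f j)
  have eq: "G (\<lambda>\<theta>. f \<theta> + t * j \<theta>) x y =
      \<phi> (arc_len L (\<lambda>\<theta>. ?w \<theta> + t * ?u \<theta>) (\<lambda>\<theta>. deriv f \<theta> + t * deriv j \<theta>)) *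
      weighted_len L (\<lambda>\<theta>. x \<theta> * y \<theta>) (\<lambda>\<theta>. ?w \<theta> + t * ?u \<theta>) (\<lambda>\<theta>. deriv f \<theta> + t * deriv j \<theta>)" for t
  proof -
    have "(\<lambda>\<theta>. 1 - (f \<theta> + t * j \<theta>) * kap \<theta>) = (\<lambda>\<theta>. ?w \<theta> + t * ?u \<theta>)"
      by (simp add: fun_eq_iff algebra_simps)
    then show ?thesis unfolding metric_eq[OF line] deriv_along_line[OF f j] by simp
  qed
  have "(\<phi> has_real_derivative deriv \<phi> (arc_len L ?w (deriv f)))
      (at (arc_len L (\<lambda>\<theta>. ?w \<theta> + 0 * ?u \<theta>) (\<lambda>\<theta>. deriv f \<theta> + 0 * deriv j \<theta>)))"
    using phi_derivative[OF arc_len_pos[OF w f' pos]] by simp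
  from DERIV_mult[OF DERIV_chain2[OF this DERIV_arc_len[OF w f' u j' pos]]
      DERIV_weighted_len[OF w f' u j' pos g]]
  show ?thesis unfolding eq by simp
qed

lemma dir_deriv_metric_zero:
  assumes j: "j \<in> circle_smooth L" and x: "x \<in> circle_smooth L" and y: "y \<in> circle_smooth L"
  shows "dir_deriv j (\<lambda>f. G f x y) (\<lambda>_. 0) =
    - deriv \<phi> L * I (\<lambda>\<theta>. j \<theta> * kap \<theta>) * I (\<lambda>\<theta>. x \<theta> * y \<theta>)
    - \<phi> L * I (\<lambda>\<theta>. j \<theta> * kap \<theta> * (x \<theta> * y \<theta>))"
  using DERIV_metric[OF circle_smooth_const j x y, of 0] length_pos
  unfolding dir_deriv_def
  by (simp add: DERIV_imp_deriv arc_len_def arc_len_variation_def weighted_len_def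
      weighted_len_variation_def inv_speed_def)

text \<open>
  The two terms containing \<open>deriv j * deriv k\<close> are the ones that decide the theorem: the first one is
  the second variation of the length, the second one that of the density.
\<close>

lemma dir_deriv2_metric_zero:
  assumes j: "j \<in> circle_smooth L" and k: "k \<in> circle_smooth L"
    and x: "x \<in> circle_smooth L" and y: "y \<in> circle_smooth L"
  shows "dir_deriv j (dir_deriv k (\<lambda>f. G f x y)) (\<lambda>_. 0) =
    (deriv (deriv \<phi>) L * I (\<lambda>\<theta>. j \<theta> * kap \<theta>) * I (\<lambda>\<theta>. k \<theta> * kap \<theta>)
      + deriv \<phi> L * I (\<lambda>\<theta>. deriv j \<theta> * deriv k \<theta>)) * I (\<lambda>\<theta>. x \<theta> * y \<theta>)
    + deriv \<phi> L * (I (\<lambda>\<theta>. k \<theta> * kap \<theta>) * I (\<lambda>\<theta>. j \<theta> * kap \<theta> * (x \<theta> * y \<theta>))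
      + I (\<lambda>\<theta>. j \<theta> * kap \<theta>) * I (\<lambda>\<theta>. k \<theta> * kap \<theta> * (x \<theta> * y \<theta>)))
    - \<phi> L * I (\<lambda>\<theta>. deriv j \<theta> * deriv k \<theta> * (x \<theta> * y \<theta>))"
proof -
  let ?a = "\<lambda>\<theta>. - (j \<theta> * kap \<theta>)" and ?u = "\<lambda>\<theta>. - (k \<theta> * kap \<theta>)" and ?g = "\<lambda>\<theta>. x \<theta> * y \<theta>"
  let ?W = "\<lambda>s \<theta>. 1 + s * ?a \<theta>" and ?P = "\<lambda>s \<theta>. s * deriv j \<theta>"
  let ?len = "\<lambda>s. arc_len L (?W s) (?P s)" and ?wl = "\<lambda>s. weighted_len L ?g (?W s) (?P s)"
  let ?A = "\<lambda>s. arc_len_variation L (?W s) (?P s) ?u (deriv k)"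
  let ?B = "\<lambda>s. weighted_len_variation L ?g (?W s) (?P s) ?u (deriv k)"
  have a: "continuous_on {0..L} ?a" and u: "continuous_on {0..L} ?u"
    and g: "continuous_on {0..L} ?g"
    by (intro continuous_intros j[THEN circle_smooth_continuous] k[THEN circle_smooth_continuous]
      x[THEN circle_smooth_continuous] y[THEN circle_smooth_continuous] kap_smooth[THEN circle_smooth_continuous])+
  have one: "continuous_on {0..L} (\<lambda>\<theta>. 1::real)" and zero: "continuous_on {0..L} (\<lambda>\<theta>. 0::real)"
    by (rule continuous_on_const)+
  note j' = circle_smooth_continuous[OF circle_smooth_deriv[OF j]]
    and k' = circle_smooth_continuous[OF circle_smooth_deriv[OF k]]
  obtain \<delta> where \<delta>: "\<delta> > 0"
    and pos: "\<And>s \<theta>. \<bar>s\<bar> < \<delta> \<Longrightarrow> \<theta> \<in> {0..L} \<Longrightarrow> ?W s \<theta> > 0"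
    using positive_perturbation[OF one a] by auto
  have first: "dir_deriv k (\<lambda>f. G f x y) (\<lambda>\<theta>. 0 + s * j \<theta>) =
      deriv \<phi> (?len s) * ?A s * ?wl s + ?B s * \<phi> (?len s)" if s: "\<bar>s\<bar> < \<delta>" for s
  proof -
    have line: "(\<lambda>\<theta>. 0 + s * j \<theta>) \<in> circle_smooth L"
      by (intro circle_smooth_add circle_smooth_mult circle_smooth_const j)
    have W: "(\<lambda>\<theta>. 1 - (0 + s * j \<theta>) * kap \<theta>) = ?W s"
      by (simp add: fun_eq_iff)
    have P: "deriv (\<lambda>\<theta>. 0 + s * j \<theta>) = ?P s"
      unfolding deriv_along_line[OF circle_smooth_const j] by simp
    have "1 - (0 + s * j \<theta>) * kap \<theta> > 0" if "\<theta> \<in> {0..L}" for \<theta>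
      using pos[OF s that] by simp
    from DERIV_metric[OF line k x y this]
    show ?thesis unfolding W P dir_deriv_def by (rule DERIV_imp_deriv)
  qed
  have base: "?len 0 = L" "?wl 0 = I ?g" "?A 0 = I ?u" "?B 0 = I (\<lambda>\<theta>. ?u \<theta> * ?g \<theta>)"
    using length_pos
    by (simp_all add: arc_len_def arc_len_variation_def weighted_len_def
      weighted_len_variation_def inv_speed_def)
  have dlen: "(?len has_real_derivative I ?a) (at 0)"
    using DERIV_arc_len[OF one zero a j'] by (simp add: arc_len_variation_def inv_speed_def)
  have dwl: "(?wl has_real_derivative I (\<lambda>\<theta>. ?a \<theta> * ?g \<theta>)) (at 0)"
    using DERIV_weighted_len[OF one zero a j' _ g] by (simp add: weighted_len_variation_def inv_speed_def)
  have dphi: "((\<lambda>s. \<phi> (?len s)) has_real_derivative deriv \<phi> L * I ?a) (at 0)"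
    by (rule DERIV_chain2[OF _ dlen]) (use phi_derivative[OF length_pos] base in simp)
  have ddphi: "((\<lambda>s. deriv \<phi> (?len s)) has_real_derivative deriv (deriv \<phi>) L * I ?a) (at 0)"
    by (rule DERIV_chain2[OF _ dlen]) (use phi_second_derivative base in simp)
  note total = DERIV_add[OF
      DERIV_mult[OF DERIV_mult[OF ddphi DERIV_arc_len_variation[OF a j' u k']] dwl]
      DERIV_mult[OF DERIV_weighted_len_variation[OF a j' u k' g] dphi]]
  have "dir_deriv j (dir_deriv k (\<lambda>f. G f x y)) (\<lambda>_. 0) =
      deriv (\<lambda>s. deriv \<phi> (?len s) * ?A s * ?wl s + ?B s * \<phi> (?len s)) 0"
    unfolding dir_deriv_def[of j]
  proof (rule deriv_cong_ev[OF _ refl])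
    show "\<forall>\<^sub>F s in nhds 0. dir_deriv k (\<lambda>f. G f x y) (\<lambda>\<theta>. 0 + s * j \<theta>) =
        deriv \<phi> (?len s) * ?A s * ?wl s + ?B s * \<phi> (?len s)"
      unfolding eventually_nhds_metric using \<delta> first by (auto simp: dist_real_def)
  qed
  also note DERIV_imp_deriv[OF total]
  finally show ?thesis
    unfolding base by (simp add: integral_neg algebra_simps)
qed

end

section \<open>Christoffel symbols and sectional curvature at the center\<close>

context arclength_curve
begin

text \<open>
  The explicit solution of the equation that determines the symbols at the center, to be identified
  with them in \<open>christoffel_zero\<close>. It involves no derivatives of its arguments.
\<close>

definition Gamma0 :: "(real \<Rightarrow> real) \<Rightarrow> (real \<Rightarrow> real) \<Rightarrow> real \<Rightarrow> real" where
  "Gamma0 h k = (\<lambda>\<theta>. 1 / 2 * (kap \<theta> * h \<theta> * k \<theta>) + deriv \<phi> L / (2 * \<phi> L) *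
     (I (\<lambda>\<theta>. h \<theta> * kap \<theta>) * k \<theta> + I (\<lambda>\<theta>. k \<theta> * kap \<theta>) * h \<theta> - I (\<lambda>\<theta>. h \<theta> * k \<theta>) * kap \<theta>))"

lemma Gamma0_smooth: "h \<in> circle_smooth L \<Longrightarrow> k \<in> circle_smooth L \<Longrightarrow> Gamma0 h k \<in> circle_smooth L"
  unfolding Gamma0_def by (intro circle_smooth_intros kap_smooth)

lemma Gamma0_inner:
  assumes h: "h \<in> circle_smooth L" and k: "k \<in> circle_smooth L" and j: "j \<in> circle_smooth L"
  shows "2 * (\<phi> L * I (\<lambda>\<theta>. Gamma0 h k \<theta> * j \<theta>)) =
    \<phi> L * I (\<lambda>\<theta>. kap \<theta> * h \<theta> * k \<theta> * j \<theta>) + deriv \<phi> L *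
     (I (\<lambda>\<theta>. h \<theta> * kap \<theta>) * I (\<lambda>\<theta>. k \<theta> * j \<theta>) + I (\<lambda>\<theta>. k \<theta> * kap \<theta>) * I (\<lambda>\<theta>. h \<theta> * j \<theta>)
       - I (\<lambda>\<theta>. h \<theta> * k \<theta>) * I (\<lambda>\<theta>. kap \<theta> * j \<theta>))"
proof -
  define A where "A = I (\<lambda>\<theta>. h \<theta> * kap \<theta>)"
  define B where "B = I (\<lambda>\<theta>. k \<theta> * kap \<theta>)"
  define D where "D = I (\<lambda>\<theta>. h \<theta> * k \<theta>)"
  have eq: "(\<lambda>\<theta>. Gamma0 h k \<theta> * j \<theta>) = (\<lambda>\<theta>. 1 / 2 * (kap \<theta> * h \<theta> * k \<theta> * j \<theta>) + deriv \<phi> L / (2 * \<phi> L) *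
     (A * (k \<theta> * j \<theta>) + B * (h \<theta> * j \<theta>) - D * (kap \<theta> * j \<theta>)))"
    unfolding Gamma0_def A_def[symmetric] B_def[symmetric] D_def[symmetric]
    by (simp add: fun_eq_iff algebra_simps add_divide_distrib)
  have "I (\<lambda>\<theta>. Gamma0 h k \<theta> * j \<theta>) = 1 / 2 * I (\<lambda>\<theta>. kap \<theta> * h \<theta> * k \<theta> * j \<theta>) + deriv \<phi> L / (2 * \<phi> L) *
     (A * I (\<lambda>\<theta>. k \<theta> * j \<theta>) + B * I (\<lambda>\<theta>. h \<theta> * j \<theta>) - D * I (\<lambda>\<theta>. kap \<theta> * j \<theta>))"
    unfolding eq by (simp only: circle_integral_linear circle_smooth_intros h k j kap_smooth)
  then show ?thesis
    unfolding A_def[symmetric] B_def[symmetric] D_def[symmetric]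
    using phi_L_pos by (simp add: field_simps)
qed

text \<open>
  The defining equation fixes the inner product with every smooth test function. The difference of two
  smooth solutions is itself an admissible test function, which yields uniqueness.
\<close>

lemma christoffel_zero:
  assumes h: "h \<in> circle_smooth L" and k: "k \<in> circle_smooth L"
  shows "christoffel \<phi> L c (\<lambda>_. 0) h k = Gamma0 h k"
  unfolding christoffel_def Let_def
proof (rule the_equality)
  have Gamma0_eq: "2 * G (\<lambda>_. 0) (Gamma0 h k) j =
      dir_deriv j (\<lambda>f. G f h k) (\<lambda>_. 0) - dir_deriv h (\<lambda>f. G f k j) (\<lambda>_. 0)
        - dir_deriv k (\<lambda>f. G f h j) (\<lambda>_. 0)" if j: "j \<in> circle_smooth L" for j
  proof -
    have comm: "kap \<theta> * h \<theta> * k \<theta> * j \<theta> = j \<theta> * kap \<theta> * (h \<theta> * k \<theta>)"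
      "h \<theta> * kap \<theta> * (k \<theta> * j \<theta>) = j \<theta> * kap \<theta> * (h \<theta> * k \<theta>)"
      "k \<theta> * kap \<theta> * (h \<theta> * j \<theta>) = j \<theta> * kap \<theta> * (h \<theta> * k \<theta>)"
      "kap \<theta> * j \<theta> = j \<theta> * kap \<theta>" for \<theta>
      by (simp_all add: algebra_simps)
    show ?thesis
      unfolding metric_at_zero Gamma0_inner[OF h k j] dir_deriv_metric_zero[OF j h k]
        dir_deriv_metric_zero[OF h k j] dir_deriv_metric_zero[OF k h j] comm
      by algebra
  qed
  show "Gamma0 h k \<in> circle_smooth L \<and> (\<forall>j\<in>circle_smooth L. 2 * G (\<lambda>_. 0) (Gamma0 h k) j =
      dir_deriv j (\<lambda>f. G f h k) (\<lambda>_. 0) - dir_deriv h (\<lambda>f. G f k j) (\<lambda>_. 0)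
        - dir_deriv k (\<lambda>f. G f h j) (\<lambda>_. 0))"
    using Gamma0_smooth[OF h k] Gamma0_eq by blast
  fix g assume g: "g \<in> circle_smooth L \<and> (\<forall>j\<in>circle_smooth L. 2 * G (\<lambda>_. 0) g j =
      dir_deriv j (\<lambda>f. G f h k) (\<lambda>_. 0) - dir_deriv h (\<lambda>f. G f k j) (\<lambda>_. 0)
        - dir_deriv k (\<lambda>f. G f h j) (\<lambda>_. 0))"
  \<comment> \<open>test the equation for \<open>g\<close> and for \<open>Gamma0 h k\<close> against their difference\<close>
  let ?d = "\<lambda>\<theta>. g \<theta> - Gamma0 h k \<theta>"
  have d: "?d \<in> circle_smooth L"
    using g Gamma0_smooth[OF h k] by (intro circle_smooth_diff) auto
  have "2 * G (\<lambda>_. 0) g ?d = 2 * G (\<lambda>_. 0) (Gamma0 h k) ?d"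
    unfolding Gamma0_eq[OF d] using g d by blast
  then have eq: "I (\<lambda>\<theta>. g \<theta> * ?d \<theta>) = I (\<lambda>\<theta>. Gamma0 h k \<theta> * ?d \<theta>)"
    using phi_L_pos unfolding metric_at_zero by simp
  have sq: "(\<lambda>\<theta>. ?d \<theta> * ?d \<theta>) = (\<lambda>\<theta>. g \<theta> * ?d \<theta> - Gamma0 h k \<theta> * ?d \<theta>)"
    by (simp add: fun_eq_iff left_diff_distrib)
  have "I (\<lambda>\<theta>. g \<theta> * ?d \<theta> - Gamma0 h k \<theta> * ?d \<theta>) =
      I (\<lambda>\<theta>. g \<theta> * ?d \<theta>) - I (\<lambda>\<theta>. Gamma0 h k \<theta> * ?d \<theta>)"
    by (rule circle_integral_diff) (rule circle_smooth_mult[OF _ d], use g Gamma0_smooth[OF h k] in simp)+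
  then have "I (\<lambda>\<theta>. ?d \<theta> * ?d \<theta>) = 0" unfolding sq eq by simp
  then have "?d = (\<lambda>_. 0)" by (rule circle_integral_square_eq_0[OF d length_pos])
  then show "g = Gamma0 h k" by (simp add: fun_eq_iff)
qed

text \<open>
  The first line carries all of the dependence on the derivative of \<open>h\<close>. In the second derivatives of
  the metric the terms with the integrals of \<open>\<kappa> m h\<^sup>2\<close> and \<open>\<kappa> h m\<^sup>2\<close> cancel, and
  \<open>m m' h h' = 1/2 m m' (h\<^sup>2)'\<close> is integrated by parts.
\<close>

lemma sectional_curvature_eq:
  assumes m: "m \<in> circle_smooth L" and h: "h \<in> circle_smooth L"
    and orth: "I (\<lambda>\<theta>. m \<theta> * h \<theta>) = 0"
    and mm: "I (\<lambda>\<theta>. m \<theta> * m \<theta>) = S" and hh: "I (\<lambda>\<theta>. h \<theta> * h \<theta>) = S"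
  shows "sectional_curvature \<phi> L c m h =
    1 / 2 * I (\<lambda>\<theta>. (\<phi> L * (m \<theta> * m \<theta>) - deriv \<phi> L * S) * (deriv h \<theta> * deriv h \<theta>))
    + \<phi> L / 2 * (I (\<lambda>\<theta>. deriv m \<theta> * deriv m \<theta> * (h \<theta> * h \<theta>))
        + I (\<lambda>\<theta>. deriv (\<lambda>\<theta>. m \<theta> * deriv m \<theta>) \<theta> * (h \<theta> * h \<theta>)))
    - 1 / 2 * (deriv (deriv \<phi>) L * ((I (\<lambda>\<theta>. m \<theta> * kap \<theta>))\<^sup>2 + (I (\<lambda>\<theta>. h \<theta> * kap \<theta>))\<^sup>2)
        + deriv \<phi> L * I (\<lambda>\<theta>. deriv m \<theta> * deriv m \<theta>)) * S
    + \<phi> L * I (\<lambda>\<theta>. Gamma0 h m \<theta> * Gamma0 h m \<theta>) - \<phi> L * I (\<lambda>\<theta>. Gamma0 m m \<theta> * Gamma0 h h \<theta>)"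
proof -
  have hm: "I (\<lambda>\<theta>. h \<theta> * m \<theta>) = 0" using orth by (simp add: mult.commute)
  have "(\<lambda>\<theta>. (\<phi> L * (m \<theta> * m \<theta>) - deriv \<phi> L * S) * (deriv h \<theta> * deriv h \<theta>)) =
      (\<lambda>\<theta>. \<phi> L * (deriv h \<theta> * deriv h \<theta> * (m \<theta> * m \<theta>)) - deriv \<phi> L * S * (deriv h \<theta> * deriv h \<theta>))"
    by (simp add: fun_eq_iff algebra_simps)
  then have lead: "I (\<lambda>\<theta>. (\<phi> L * (m \<theta> * m \<theta>) - deriv \<phi> L * S) * (deriv h \<theta> * deriv h \<theta>)) =
      \<phi> L * I (\<lambda>\<theta>. deriv h \<theta> * deriv h \<theta> * (m \<theta> * m \<theta>)) - deriv \<phi> L * S * I (\<lambda>\<theta>. deriv h \<theta> * deriv h \<theta>)"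
    by (simp only: circle_integral_linear circle_smooth_intros h m)
  have mm': "(\<lambda>\<theta>. m \<theta> * deriv m \<theta>) \<in> circle_smooth L" and h2: "(\<lambda>\<theta>. h \<theta> * h \<theta>) \<in> circle_smooth L"
    by (intro circle_smooth_intros m h)+
  \<comment> \<open>remove the derivative of \<open>h\<close> from the mixed term\<close>
  have "deriv (\<lambda>\<theta>. h \<theta> * h \<theta>) \<theta> = 2 * (h \<theta> * deriv h \<theta>)" for \<theta>
    using DERIV_mult[OF circle_smooth_has_derivative[OF h] circle_smooth_has_derivative[OF h], of \<theta>]
    by (simp add: DERIV_imp_deriv algebra_simps)
  then have "(\<lambda>\<theta>. m \<theta> * deriv m \<theta> * deriv (\<lambda>\<theta>. h \<theta> * h \<theta>) \<theta>) =
      (\<lambda>\<theta>. 2 * (deriv m \<theta> * deriv h \<theta> * (h \<theta> * m \<theta>)))"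
    by (simp add: fun_eq_iff algebra_simps)
  then have cross: "2 * I (\<lambda>\<theta>. deriv m \<theta> * deriv h \<theta> * (h \<theta> * m \<theta>)) =
      - I (\<lambda>\<theta>. deriv (\<lambda>\<theta>. m \<theta> * deriv m \<theta>) \<theta> * (h \<theta> * h \<theta>))"
    using circle_integral_by_parts[OF mm' h2 length_pos] by simp
  have comm: "m \<theta> * kap \<theta> * (h \<theta> * m \<theta>) = h \<theta> * kap \<theta> * (m \<theta> * m \<theta>)"
    "h \<theta> * kap \<theta> * (h \<theta> * m \<theta>) = m \<theta> * kap \<theta> * (h \<theta> * h \<theta>)" for \<theta>
    by (simp_all add: algebra_simps)
  have "I (\<lambda>\<theta>. deriv (\<lambda>\<theta>. m \<theta> * deriv m \<theta>) \<theta> * (h \<theta> * h \<theta>)) =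
      - 2 * I (\<lambda>\<theta>. deriv m \<theta> * deriv h \<theta> * (h \<theta> * m \<theta>))" using cross by simp
  then show ?thesis
    unfolding sectional_curvature_def Let_def christoffel_zero[OF h m] christoffel_zero[OF m m]
      christoffel_zero[OF h h] metric_at_zero dir_deriv2_metric_zero[OF m h h m]
      dir_deriv2_metric_zero[OF m m h h] dir_deriv2_metric_zero[OF h h m m] lead mm hh hm comm
    by (simp add: field_simps power2_eq_square)
qed

end

section \<open>The curvature up to bounded terms\<close>

text \<open>
  The remainder is a polynomial in integrals that are linear or quadratic in \<open>h\<close>, so its boundedness
  follows by closure rules from the boundedness of these integrals on spheres of \<open>L\<^sup>2\<close>.
\<close>

definition bounded_over :: "'a set \<Rightarrow> ('a \<Rightarrow> real) \<Rightarrow> bool" where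
  "bounded_over H F \<longleftrightarrow> (\<exists>C. \<forall>h\<in>H. \<bar>F h\<bar> \<le> C)"

lemma bounded_over_const: "bounded_over H (\<lambda>h. k)"
  unfolding bounded_over_def by blast

lemma bounded_over_add:
  assumes "bounded_over H F" "bounded_over H F'"
  shows "bounded_over H (\<lambda>h. F h + F' h)"
proof -
  obtain C C' where "\<And>h. h \<in> H \<Longrightarrow> \<bar>F h\<bar> \<le> C" "\<And>h. h \<in> H \<Longrightarrow> \<bar>F' h\<bar> \<le> C'"
    using assms unfolding bounded_over_def by blast
  then show ?thesis
    unfolding bounded_over_def by (metis abs_triangle_ineq add_mono order_trans)
qed

lemma bounded_over_mult:
  assumes "bounded_over H F" "bounded_over H F'"
  shows "bounded_over H (\<lambda>h. F h * F' h)"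
proof -
  obtain C C' where "\<And>h. h \<in> H \<Longrightarrow> \<bar>F h\<bar> \<le> C" "\<And>h. h \<in> H \<Longrightarrow> \<bar>F' h\<bar> \<le> C'"
    using assms unfolding bounded_over_def by blast
  then have "\<bar>F h * F' h\<bar> \<le> C * C'" if "h \<in> H" for h
    using that unfolding abs_mult by (meson abs_ge_zero mult_mono order_trans)
  then show ?thesis unfolding bounded_over_def by blast
qed

lemma bounded_over_diff:
  assumes "bounded_over H F" "bounded_over H F'"
  shows "bounded_over H (\<lambda>h. F h - F' h)"
  using bounded_over_add[OF assms(1) bounded_over_mult[OF bounded_over_const[of H "-1"] assms(2)]]
  by simp

lemmas bounded_over_intros =
  bounded_over_const bounded_over_add bounded_over_diff bounded_over_mult

definition circle_sphere :: "real \<Rightarrow> real \<Rightarrow> (real \<Rightarrow> real) set" where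
  "circle_sphere L S = {h \<in> circle_smooth L. integral {0..L} (\<lambda>\<theta>. h \<theta> * h \<theta>) = S}"

lemma bounded_over_quadratic:
  assumes v: "v \<in> circle_smooth L" and L: "L > 0"
  shows "bounded_over (circle_sphere L S) (\<lambda>h. integral {0..L} (\<lambda>\<theta>. v \<theta> * (h \<theta> * h \<theta>)))"
proof -
  obtain V where V: "V \<ge> 0" "\<And>x. \<bar>v x\<bar> \<le> V" using circle_smooth_bounded[OF v L] by blast
  have "\<bar>integral {0..L} (\<lambda>\<theta>. v \<theta> * (h \<theta> * h \<theta>))\<bar> \<le> V * S" if "h \<in> circle_sphere L S" for h
  proof -
    have h: "h \<in> circle_smooth L" and S: "integral {0..L} (\<lambda>\<theta>. h \<theta> * h \<theta>) = S"
      using that by (auto simp: circle_sphere_def)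
    have "\<bar>integral {0..L} (\<lambda>\<theta>. v \<theta> * (h \<theta> * h \<theta>))\<bar> \<le> integral {0..L} (\<lambda>\<theta>. V * (h \<theta> * h \<theta>))"
      by (intro integral_norm_bound_integral[where 'a = real, unfolded real_norm_def] circle_smooth_integrable circle_smooth_intros h v)
        (auto simp: abs_mult intro!: mult_right_mono V(2))
    then show ?thesis by (simp add: S)
  qed
  then show ?thesis unfolding bounded_over_def by blast
qed

text \<open>
  The elementary bound \<open>\<bar>h\<bar> \<le> 1 + h\<^sup>2\<close> reduces the linear case to the quadratic one.
\<close>

lemma bounded_over_linear:
  assumes v: "v \<in> circle_smooth L" and L: "L > 0"
  shows "bounded_over (circle_sphere L S) (\<lambda>h. integral {0..L} (\<lambda>\<theta>. v \<theta> * h \<theta>))"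
proof -
  obtain V where V: "V \<ge> 0" "\<And>x. \<bar>v x\<bar> \<le> V" using circle_smooth_bounded[OF v L] by blast
  have "\<bar>integral {0..L} (\<lambda>\<theta>. v \<theta> * h \<theta>)\<bar> \<le> V * (L + S)" if "h \<in> circle_sphere L S" for h
  proof -
    have h: "h \<in> circle_smooth L" and S: "integral {0..L} (\<lambda>\<theta>. h \<theta> * h \<theta>) = S"
      using that by (auto simp: circle_sphere_def)
    have "\<bar>v x * h x\<bar> \<le> V * (1 + h x * h x)" for x
    proof -
      have "\<bar>h x\<bar> \<le> 1 + h x * h x"
        using zero_le_power2[of "\<bar>h x\<bar> - 1"] by (simp add: power2_diff) (simp add: power2_eq_square)
      then show ?thesis unfolding abs_mult by (intro mult_mono V) auto
    qed
    then have "\<bar>integral {0..L} (\<lambda>\<theta>. v \<theta> * h \<theta>)\<bar> \<le> integral {0..L} (\<lambda>\<theta>. V * (1 + h \<theta> * h \<theta>))"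
      by (intro integral_norm_bound_integral[where 'a = real, unfolded real_norm_def] circle_smooth_integrable circle_smooth_intros h v)
    also have "\<dots> = V * (L + S)"
      using L circle_integral_add[OF circle_smooth_const[of 1] circle_smooth_mult[OF h h]]
      by (simp add: S)
    finally show ?thesis .
  qed
  then show ?thesis unfolding bounded_over_def by blast
qed

context arclength_curve
begin

lemma Gamma0_orthogonal_norm:
  assumes m: "m \<in> circle_smooth L" and h: "h \<in> circle_smooth L"
    and orth: "I (\<lambda>\<theta>. m \<theta> * h \<theta>) = 0"
    and mm: "I (\<lambda>\<theta>. m \<theta> * m \<theta>) = S" and hh: "I (\<lambda>\<theta>. h \<theta> * h \<theta>) = S"
  defines "A \<equiv> I (\<lambda>\<theta>. kap \<theta> * h \<theta>)" and "B \<equiv> I (\<lambda>\<theta>. kap \<theta> * m \<theta>)" and "r \<equiv> deriv \<phi> L / (2 * \<phi> L)"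
  shows "I (\<lambda>\<theta>. Gamma0 h m \<theta> * Gamma0 h m \<theta>) =
    1 / 4 * I (\<lambda>\<theta>. kap \<theta> * kap \<theta> * (m \<theta> * m \<theta>) * (h \<theta> * h \<theta>))
    + r * (A * I (\<lambda>\<theta>. kap \<theta> * (m \<theta> * m \<theta>) * h \<theta>) + B * I (\<lambda>\<theta>. kap \<theta> * m \<theta> * (h \<theta> * h \<theta>)))
    + r * r * (A * A * S + B * B * S)"
proof -
  have AB: "I (\<lambda>\<theta>. h \<theta> * kap \<theta>) = A" "I (\<lambda>\<theta>. m \<theta> * kap \<theta>) = B" and hm: "I (\<lambda>\<theta>. h \<theta> * m \<theta>) = 0"
    unfolding A_def B_def using orth by (simp_all add: mult.commute)
  have "Gamma0 h m = (\<lambda>\<theta>. 1 / 2 * (kap \<theta> * h \<theta> * m \<theta>) + r * (A * m \<theta> + B * h \<theta>))"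
    unfolding Gamma0_def AB hm r_def by simp
  then have "(\<lambda>\<theta>. Gamma0 h m \<theta> * Gamma0 h m \<theta>) = (\<lambda>\<theta>.
    1 / 4 * (kap \<theta> * kap \<theta> * (m \<theta> * m \<theta>) * (h \<theta> * h \<theta>))
    + r * (A * (kap \<theta> * (m \<theta> * m \<theta>) * h \<theta>) + B * (kap \<theta> * m \<theta> * (h \<theta> * h \<theta>)))
    + r * r * (A * A * (m \<theta> * m \<theta>) + B * B * (h \<theta> * h \<theta>) + 2 * A * B * (m \<theta> * h \<theta>)))"
    by (simp add: fun_eq_iff algebra_simps)
  then have "I (\<lambda>\<theta>. Gamma0 h m \<theta> * Gamma0 h m \<theta>) =
    1 / 4 * I (\<lambda>\<theta>. kap \<theta> * kap \<theta> * (m \<theta> * m \<theta>) * (h \<theta> * h \<theta>))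
    + r * (A * I (\<lambda>\<theta>. kap \<theta> * (m \<theta> * m \<theta>) * h \<theta>) + B * I (\<lambda>\<theta>. kap \<theta> * m \<theta> * (h \<theta> * h \<theta>)))
    + r * r * (A * A * I (\<lambda>\<theta>. m \<theta> * m \<theta>) + B * B * I (\<lambda>\<theta>. h \<theta> * h \<theta>) + 2 * A * B * I (\<lambda>\<theta>. m \<theta> * h \<theta>))"
    by (simp only: circle_integral_linear circle_smooth_intros m h kap_smooth)
  then show ?thesis unfolding mm hh orth by simp
qed

text \<open>
  The leading term has the only derivatives of \<open>h\<close>. In the other terms \<open>h\<close> enters through integrals
  against fixed smooth functions, linearly or quadratically, and these are bounded on spheres.
\<close>

lemma curvature_remainder_bounded:
  assumes m: "m \<in> circle_smooth L" and mm: "I (\<lambda>\<theta>. m \<theta> * m \<theta>) = S"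
  obtains C where "\<And>h. h \<in> circle_sphere L S \<Longrightarrow> I (\<lambda>\<theta>. m \<theta> * h \<theta>) = 0 \<Longrightarrow>
    \<bar>sectional_curvature \<phi> L c m h
      - 1 / 2 * I (\<lambda>\<theta>. (\<phi> L * (m \<theta> * m \<theta>) - deriv \<phi> L * S) * (deriv h \<theta> * deriv h \<theta>))\<bar> \<le> C"
proof -
  define r where "r = deriv \<phi> L / (2 * \<phi> L)"
  define A where "A = (\<lambda>h. I (\<lambda>\<theta>. kap \<theta> * h \<theta>))"
  define \<mu> where "\<mu> = Gamma0 m m"
  define R where "R = (\<lambda>h.
    \<phi> L / 2 * (I (\<lambda>\<theta>. deriv m \<theta> * deriv m \<theta> * (h \<theta> * h \<theta>))
        + I (\<lambda>\<theta>. deriv (\<lambda>\<theta>. m \<theta> * deriv m \<theta>) \<theta> * (h \<theta> * h \<theta>)))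
    - 1 / 2 * (deriv (deriv \<phi>) L * (A m * A m + A h * A h)
        + deriv \<phi> L * I (\<lambda>\<theta>. deriv m \<theta> * deriv m \<theta>)) * S
    + \<phi> L * (1 / 4 * I (\<lambda>\<theta>. kap \<theta> * kap \<theta> * (m \<theta> * m \<theta>) * (h \<theta> * h \<theta>))
      + r * (A h * I (\<lambda>\<theta>. kap \<theta> * (m \<theta> * m \<theta>) * h \<theta>) + A m * I (\<lambda>\<theta>. kap \<theta> * m \<theta> * (h \<theta> * h \<theta>)))
      + r * r * (A h * A h * S + A m * A m * S))
    - 1 / 2 * (\<phi> L * I (\<lambda>\<theta>. kap \<theta> * \<mu> \<theta> * (h \<theta> * h \<theta>)) + deriv \<phi> L *
       (2 * A h * I (\<lambda>\<theta>. \<mu> \<theta> * h \<theta>) - S * A \<mu>)))"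
  have \<mu>: "\<mu> \<in> circle_smooth L" unfolding \<mu>_def by (rule Gamma0_smooth[OF m m])
  have "bounded_over (circle_sphere L S) R"
    unfolding R_def A_def
    by (intro bounded_over_intros bounded_over_quadratic bounded_over_linear length_pos
        circle_smooth_intros kap_smooth m \<mu>)
  then obtain C where C: "\<And>h. h \<in> circle_sphere L S \<Longrightarrow> \<bar>R h\<bar> \<le> C"
    unfolding bounded_over_def by blast
  have rem: "sectional_curvature \<phi> L c m h
      - 1 / 2 * I (\<lambda>\<theta>. (\<phi> L * (m \<theta> * m \<theta>) - deriv \<phi> L * S) * (deriv h \<theta> * deriv h \<theta>)) = R h"
    if h_sphere: "h \<in> circle_sphere L S" and orth: "I (\<lambda>\<theta>. m \<theta> * h \<theta>) = 0" for h
  proof -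
    have h: "h \<in> circle_smooth L" and hh: "I (\<lambda>\<theta>. h \<theta> * h \<theta>) = S"
      using h_sphere by (auto simp: circle_sphere_def)
    have A: "I (\<lambda>\<theta>. u \<theta> * kap \<theta>) = A u" "I (\<lambda>\<theta>. kap \<theta> * u \<theta>) = A u" for u
      unfolding A_def by (simp_all add: mult.commute)
    have comm: "kap \<theta> * h \<theta> * h \<theta> * \<mu> \<theta> = kap \<theta> * \<mu> \<theta> * (h \<theta> * h \<theta>)" "h \<theta> * \<mu> \<theta> = \<mu> \<theta> * h \<theta>"
      "Gamma0 h h \<theta> * \<mu> \<theta> = \<mu> \<theta> * Gamma0 h h \<theta>" for \<theta>
      by simp_all
    have "\<phi> L * I (\<lambda>\<theta>. \<mu> \<theta> * Gamma0 h h \<theta>) =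
        1 / 2 * (\<phi> L * I (\<lambda>\<theta>. kap \<theta> * \<mu> \<theta> * (h \<theta> * h \<theta>)) + deriv \<phi> L *
       (2 * A h * I (\<lambda>\<theta>. \<mu> \<theta> * h \<theta>) - S * A \<mu>))"
      using Gamma0_inner[OF h h \<mu>] unfolding A hh comm by (simp add: algebra_simps)
    then show ?thesis
      unfolding sectional_curvature_eq[OF m h orth mm hh] Gamma0_orthogonal_norm[OF m h orth mm hh]
        R_def A \<mu>_def[symmetric] r_def[symmetric]
      by (simp add: power2_eq_square)
  qed
  show ?thesis
    by (rule that[of C]) (simp only: rem C)
qed

end

section \<open>Concentrated high-frequency functions\<close>

text \<open>
  The function \<open>g\<^sup>2 = exp (N a)\<close> is smooth and puts its weight where \<open>a\<close> is largest, which makes bump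
  functions unnecessary. The pointwise bound \<open>t exp (N t) \<ge> N (max 0 t)\<^sup>2 - 1 / N\<close> shows that the
  positive part of \<open>a\<close> wins for large \<open>N\<close>.
\<close>

lemma concentrated_weight:
  fixes a :: "real \<Rightarrow> real"
  assumes a: "a \<in> circle_smooth L" and L: "L > 0" and pos: "a \<theta>\<^sub>0 > 0"
  obtains g where "g \<in> circle_smooth L" "integral {0..L} (\<lambda>x. a x * (g x * g x)) > 0"
proof -
  let ?p = "\<lambda>x. (max 0 (a x))\<^sup>2"
  have p: "continuous_on {0..L} ?p"
    by (intro continuous_intros circle_smooth_continuous[OF a])
  obtain y where "y \<in> {0..L}" "a y = a \<theta>\<^sub>0" using circle_smooth_representative[OF a L] .
  then have "integral {0..L} ?p \<noteq> 0"
    using integral_eq_0_iff[OF p L] pos by force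
  moreover have "integral {0..L} ?p \<ge> 0"
    using p by (intro integral_nonneg integrable_continuous_real) auto
  ultimately have Q: "integral {0..L} ?p > 0" by simp
  \<comment> \<open>large enough that the integral of \<open>N * ?p - 1 / N\<close> is positive\<close>
  define N where "N = L / integral {0..L} ?p + 1"
  have N: "N \<ge> 1" "L < N * integral {0..L} ?p"
    using Q L by (simp_all add: N_def field_simps)
  have bound: "N * (max 0 t)\<^sup>2 - 1 / N \<le> t * exp (N * t)" for t :: real
  proof (cases "t \<ge> 0")
    case True
    have "N * t \<le> exp (N * t)" using exp_ge_add_one_self[of "N * t"] by linarith
    then have "t * (N * t) \<le> t * exp (N * t)" using True by (rule mult_left_mono)
    moreover have "N * t\<^sup>2 - 1 / N \<le> t * (N * t)" using N by (simp add: power2_eq_square)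
    ultimately show ?thesis using True by simp
  next
    case False
    have "- (N * t) \<le> exp (- (N * t))" using exp_ge_add_one_self[of "- (N * t)"] by linarith
    then have "- (N * t) * exp (N * t) \<le> exp (- (N * t)) * exp (N * t)"
      by (intro mult_right_mono) auto
    then have "- 1 \<le> N * (t * exp (N * t))" by (simp flip: exp_add)
    then have "- 1 / N \<le> t * exp (N * t)" using N(1) by (simp add: field_simps)
    then show ?thesis using False by simp
  qed
  let ?g = "\<lambda>x. exp (N / 2 * a x)"
  have g: "?g \<in> circle_smooth L"
    by (intro circle_smooth_exp circle_smooth_intros a)
  have "?g x * ?g x = exp (N * a x)" for x
    by (simp flip: exp_add add: field_simps)
  then have eq: "(\<lambda>x. a x * (?g x * ?g x)) = (\<lambda>x. a x * exp (N * a x))" by simp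
  have "0 < N * integral {0..L} ?p - L / N"
  proof -
    have "L / N \<le> L / 1" using N(1) L by (intro divide_left_mono) auto
    then show ?thesis using N(2) by simp
  qed
  also have "\<dots> = integral {0..L} (\<lambda>x. N * ?p x - 1 / N)"
    using L p by (subst integral_diff)
      (auto intro!: integrable_continuous_real continuous_intros circle_smooth_continuous[OF a])
  also have "\<dots> \<le> integral {0..L} (\<lambda>x. a x * exp (N * a x))"
    using bound
    by (intro integral_le integrable_continuous_real continuous_intros circle_smooth_continuous[OF a]) auto
  finally show ?thesis using that[OF g] eq by simp
qed

text \<open>
  Here \<open>p\<close> and \<open>q\<close> play the roles of a cosine and a sine of frequency \<open>k\<close>, with any phase, and
  the constant \<open>D\<close> depends neither on the frequency nor on the phase. The dominant part of the energy is
  \<open>k\<^sup>2 \<integral> a g\<^sup>2 q\<^sup>2\<close>. Since \<open>2 q\<^sup>2 = 1 + (q\<^sup>2 - p\<^sup>2) = 1 + (p q)' / k\<close>, an integration by parts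
  replaces \<open>q\<^sup>2\<close> by its mean \<open>1/2\<close> at the cost of one power of \<open>k\<close>.
\<close>

lemma oscillation_energy:
  fixes a g :: "real \<Rightarrow> real"
  assumes a: "a \<in> circle_smooth L" and g: "g \<in> circle_smooth L" and L: "L > 0"
  obtains D where "\<And>k p q. k > 0 \<Longrightarrow> p \<in> circle_smooth L \<Longrightarrow> q \<in> circle_smooth L \<Longrightarrow>
      (\<And>x. (p has_real_derivative k * q x) (at x)) \<Longrightarrow>
      (\<And>x. (q has_real_derivative - (k * p x)) (at x)) \<Longrightarrow>
      (\<And>x. (p x)\<^sup>2 + (q x)\<^sup>2 = 1) \<Longrightarrow>
      integral {0..L} (\<lambda>x. a x * (deriv (\<lambda>x. g x * p x) x * deriv (\<lambda>x. g x * p x) x))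
        \<ge> k\<^sup>2 / 2 * integral {0..L} (\<lambda>x. a x * (g x * g x)) - D * (k + 1)"
proof -
  let ?I = "integral {0..L}"
  define F where "F = (\<lambda>x. a x * (g x * g x))"
  define F1 where "F1 = (\<lambda>x. a x * (g x * deriv g x))"
  define F2 where "F2 = (\<lambda>x. a x * (deriv g x * deriv g x))"
  have F: "F \<in> circle_smooth L" and F1: "F1 \<in> circle_smooth L" and F2: "F2 \<in> circle_smooth L"
    unfolding F_def F1_def F2_def by (intro circle_smooth_intros a g)+
  have F': "deriv F \<in> circle_smooth L" by (rule circle_smooth_deriv[OF F])
  obtain B B1 B2 where B: "B \<ge> 0" "\<And>x. \<bar>deriv F x\<bar> \<le> B" and B1: "B1 \<ge> 0" "\<And>x. \<bar>F1 x\<bar> \<le> B1"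
    and B2: "B2 \<ge> 0" "\<And>x. \<bar>F2 x\<bar> \<le> B2"
    using circle_smooth_bounded[OF F' L] circle_smooth_bounded[OF F1 L] circle_smooth_bounded[OF F2 L]
    by metis
  define D where "D = L * B + 2 * (L * B1) + L * B2"
  show ?thesis
  proof (rule that[of D])
    fix k :: real and p q :: "real \<Rightarrow> real"
    assume k: "k > 0" and p: "p \<in> circle_smooth L" and q: "q \<in> circle_smooth L"
      and dp: "\<And>x. (p has_real_derivative k * q x) (at x)"
      and dq: "\<And>x. (q has_real_derivative - (k * p x)) (at x)"
      and one: "\<And>x. (p x)\<^sup>2 + (q x)\<^sup>2 = 1"
    have p1: "\<bar>p x\<bar> \<le> 1" and q1: "\<bar>q x\<bar> \<le> 1" for x
      using one[of x] zero_le_power2[of "p x"] zero_le_power2[of "q x"]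
      unfolding abs_square_le_1[symmetric] by linarith+
    have pq: "(\<lambda>x. p x * q x) \<in> circle_smooth L" by (intro circle_smooth_intros p q)
    have pq1: "\<bar>p x * q x\<bar> \<le> 1" and pp1: "\<bar>p x * p x\<bar> \<le> 1" for x
      unfolding abs_mult by (rule mult_le_one; simp add: p1 q1)+
    have dpq: "deriv (\<lambda>x. p x * q x) x = k * (q x * q x - p x * p x)" for x
      using DERIV_mult[OF dp dq, of x] by (simp add: DERIV_imp_deriv algebra_simps)
    have small: "\<bar>?I (\<lambda>x. u x * v x)\<bar> \<le> L * C"
      if "u \<in> circle_smooth L" "v \<in> circle_smooth L" "\<And>x. \<bar>u x\<bar> \<le> C" "\<And>x. \<bar>v x\<bar> \<le> 1" for u v C
    proof (rule circle_integral_abs_le[OF L circle_smooth_mult])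
      show "\<bar>u x * v x\<bar> \<le> C" for x
        using mult_mono[OF that(3)[of x] that(4)[of x]] that(3)[of x] by (simp add: abs_mult)
    qed (use that in auto)
    have "?I (\<lambda>x. F x * deriv (\<lambda>x. p x * q x) x) = - ?I (\<lambda>x. deriv F x * (p x * q x))"
      by (rule circle_integral_by_parts[OF F pq L])
    then have E0: "\<bar>?I (\<lambda>x. F x * (k * (q x * q x - p x * p x)))\<bar> \<le> L * B"
      using small[OF F' pq B(2) pq1] unfolding dpq by simp
    have E1: "\<bar>?I (\<lambda>x. F1 x * (p x * q x))\<bar> \<le> L * B1"
      by (rule small[OF F1 pq B1(2) pq1])
    have E2: "\<bar>?I (\<lambda>x. F2 x * (p x * p x))\<bar> \<le> L * B2"
      by (rule small[OF F2 circle_smooth_mult[OF p p] B2(2) pp1])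
    have df: "deriv (\<lambda>x. g x * p x) x = deriv g x * p x + k * (g x * q x)" for x
      using DERIV_mult[OF circle_smooth_has_derivative[OF g] dp, of x]
      by (simp add: DERIV_imp_deriv algebra_simps)
    have "a x * (deriv (\<lambda>x. g x * p x) x * deriv (\<lambda>x. g x * p x) x) =
      k\<^sup>2 / 2 * F x + k / 2 * (F x * (k * (q x * q x - p x * p x)))
        + 2 * k * (F1 x * (p x * q x)) + F2 x * (p x * p x)" for x
    proof -
      \<comment> \<open>split \<open>q\<^sup>2\<close> into its mean and an exact derivative\<close>
      have "k\<^sup>2 * F x * (q x)\<^sup>2 = k\<^sup>2 / 2 * F x * ((p x)\<^sup>2 + (q x)\<^sup>2)
          + k / 2 * (F x * (k * (q x * q x - p x * p x)))"
        by (simp add: power2_eq_square algebra_simps)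
      then have "k\<^sup>2 * F x * (q x)\<^sup>2 = k\<^sup>2 / 2 * F x + k / 2 * (F x * (k * (q x * q x - p x * p x)))"
        by (simp add: one)
      then show ?thesis
        unfolding df F_def F1_def F2_def by (simp add: power2_eq_square algebra_simps)
    qed
    then have eq: "?I (\<lambda>x. a x * (deriv (\<lambda>x. g x * p x) x * deriv (\<lambda>x. g x * p x) x)) =
      k\<^sup>2 / 2 * ?I F + k / 2 * ?I (\<lambda>x. F x * (k * (q x * q x - p x * p x)))
        + 2 * k * ?I (\<lambda>x. F1 x * (p x * q x)) + ?I (\<lambda>x. F2 x * (p x * p x))"
      by (simp only: circle_integral_linear circle_smooth_intros F F1 F2 p q)
    have lower: "- (s * C) \<le> s * t" if "\<bar>t\<bar> \<le> C" "s \<ge> 0" for s t C :: real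
      using mult_left_mono[of "- C" t s] that by auto
    have "k / 2 * ?I (\<lambda>x. F x * (k * (q x * q x - p x * p x))) \<ge> - (k / 2 * (L * B))"
      "2 * k * ?I (\<lambda>x. F1 x * (p x * q x)) \<ge> - (2 * k * (L * B1))"
      using lower[OF E0] lower[OF E1] k by simp_all
    moreover have "?I (\<lambda>x. F2 x * (p x * p x)) \<ge> - (L * B2)" using E2 by simp
    moreover have "D * (k + 1) \<ge> k / 2 * (L * B) + 2 * k * (L * B1) + L * B2"
    proof -
      have "0 \<le> k / 2 * (L * B)" "0 \<le> L * B" "0 \<le> L * B1" "0 \<le> k * (L * B2)"
        using k L B(1) B1(1) B2(1) by auto
      then show ?thesis by (simp add: D_def algebra_simps)
    qed
    ultimately have "?I (\<lambda>x. a x * (deriv (\<lambda>x. g x * p x) x * deriv (\<lambda>x. g x * p x) x)) \<ge>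
        k\<^sup>2 / 2 * ?I F - D * (k + 1)"
      unfolding eq by linarith
    then show "k\<^sup>2 / 2 * ?I (\<lambda>x. a x * (g x * g x)) - D * (k + 1) \<le>
        ?I (\<lambda>x. a x * (deriv (\<lambda>x. g x * p x) x * deriv (\<lambda>x. g x * p x) x))"
      unfolding F_def .
  qed
qed

text \<open>
  Used to choose the phase of a wave so that it becomes orthogonal to a given function.
\<close>

lemma unit_vector_orthogonal:
  fixes x y :: real
  obtains \<alpha> \<beta> where "\<alpha>\<^sup>2 + \<beta>\<^sup>2 = 1" "\<alpha> * x + \<beta> * y = 0"
proof (cases "x\<^sup>2 + y\<^sup>2 = 0")
  case True
  then show ?thesis using that[of 1 0] by simp
next
  case False
  let ?r = "sqrt (x\<^sup>2 + y\<^sup>2)"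
  have "(y / ?r)\<^sup>2 + (- x / ?r)\<^sup>2 = 1"
    using False by (simp add: power_divide flip: add_divide_distrib)
  then show ?thesis using that[of "y / ?r" "- x / ?r"] by (simp add: field_simps)
qed

text \<open>
  If \<open>a\<close> is positive somewhere, the quadratic form \<open>\<integral> a f'\<^sup>2\<close> is not bounded above by a multiple of
  \<open>\<integral> f\<^sup>2\<close>, not even on the orthogonal complement of a given \<open>m\<close>: a localized wave of any
  frequency can be made orthogonal to \<open>m\<close> by its phase, while its energy grows quadratically in
  the frequency.
\<close>

lemma high_energy_orthogonal:
  fixes a m :: "real \<Rightarrow> real"
  assumes a: "a \<in> circle_smooth L" and m: "m \<in> circle_smooth L" and L: "L > 0" and pos: "a \<theta>\<^sub>0 > 0"
  obtains f where "f \<in> circle_smooth L" "integral {0..L} (\<lambda>x. m x * f x) = 0"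
    "integral {0..L} (\<lambda>x. a x * (deriv f x * deriv f x)) > C * integral {0..L} (\<lambda>x. f x * f x)"
proof -
  let ?I = "integral {0..L}"
  obtain g where g: "g \<in> circle_smooth L" and J: "?I (\<lambda>x. a x * (g x * g x)) > 0"
    using concentrated_weight[OF a L pos] .
  obtain D where D: "\<And>k p q. k > 0 \<Longrightarrow> p \<in> circle_smooth L \<Longrightarrow> q \<in> circle_smooth L \<Longrightarrow>
      (\<And>x. (p has_real_derivative k * q x) (at x)) \<Longrightarrow>
      (\<And>x. (q has_real_derivative - (k * p x)) (at x)) \<Longrightarrow>
      (\<And>x. (p x)\<^sup>2 + (q x)\<^sup>2 = 1) \<Longrightarrow>
      ?I (\<lambda>x. a x * (deriv (\<lambda>x. g x * p x) x * deriv (\<lambda>x. g x * p x) x))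
        \<ge> k\<^sup>2 / 2 * ?I (\<lambda>x. a x * (g x * g x)) - D * (k + 1)"
    using oscillation_energy[OF a g L] by blast
  define J where "J = ?I (\<lambda>x. a x * (g x * g x))"
  define S where "S = ?I (\<lambda>x. g x * g x)"
  \<comment> \<open>beyond \<open>X\<close> the term quadratic in the frequency exceeds the error term and \<open>\<bar>C\<bar> * S\<close> together\<close>
  define X where "X = 2 * (2 * \<bar>D\<bar> + \<bar>C\<bar> * S) / J + 1"
  obtain n :: nat where n: "real n > X * L" using reals_Archimedean2 by blast
  define k where "k = 2 * pi * real n / L"
  have S: "S \<ge> 0" unfolding S_def
    by (intro integral_nonneg circle_smooth_integrable circle_smooth_mult g) auto
  have Jpos: "J > 0" using J unfolding J_def .
  have X: "X \<ge> 1" using S Jpos by (simp add: X_def)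
  have "real n / L > X" using n L by (simp add: field_simps)
  moreover have "k \<ge> real n / L"
    using pi_gt3 L unfolding k_def
    by (intro divide_right_mono) (auto intro!: mult_right_mono[of 1 "2 * pi" "real n", simplified])
  ultimately have kX: "k > X" by linarith
  then have k1: "k > 1" using X by linarith
  have per: "k * (x + L) = k * x + 2 * real n * pi" for x
    using L by (simp add: k_def field_simps)
  obtain \<alpha> \<beta> where unit: "\<alpha>\<^sup>2 + \<beta>\<^sup>2 = 1"
    and orth: "\<alpha> * ?I (\<lambda>x. m x * g x * cos (k * x)) + \<beta> * ?I (\<lambda>x. m x * g x * sin (k * x)) = 0"
    by (rule unit_vector_orthogonal)
  have osc: "(\<lambda>x. \<alpha> * cos (k * x) + \<beta> * sin (k * x)) \<in> circle_smooth L" for \<alpha> \<beta>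
    unfolding circle_smooth_def
    by (auto simp: smooth_oscillation per sin_add cos_add)
  let ?p = "\<lambda>x. \<alpha> * cos (k * x) + \<beta> * sin (k * x)" and ?q = "\<lambda>x. \<beta> * cos (k * x) + (- \<alpha>) * sin (k * x)"
  have cos: "(\<lambda>x. cos (k * x)) \<in> circle_smooth L" and sin: "(\<lambda>x. sin (k * x)) \<in> circle_smooth L"
    using osc[of 1 0] osc[of 0 1] by simp_all
  let ?f = "\<lambda>x. g x * ?p x"
  have f: "?f \<in> circle_smooth L" by (intro circle_smooth_mult g osc)
  have "?I (\<lambda>x. m x * ?f x) =
      ?I (\<lambda>x. \<alpha> * (m x * g x * cos (k * x)) + \<beta> * (m x * g x * sin (k * x)))"
    by (simp add: algebra_simps)
  also have "\<dots> = \<alpha> * ?I (\<lambda>x. m x * g x * cos (k * x)) + \<beta> * ?I (\<lambda>x. m x * g x * sin (k * x))"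
    by (simp only: circle_integral_linear circle_smooth_intros m g cos sin)
  also note orth
  finally have mf: "?I (\<lambda>x. m x * ?f x) = 0" .
  have sq: "(?p x)\<^sup>2 + (?q x)\<^sup>2 = 1" for x
  proof -
    have "(?p x)\<^sup>2 + (?q x)\<^sup>2 = (\<alpha>\<^sup>2 + \<beta>\<^sup>2) * ((sin (k * x))\<^sup>2 + (cos (k * x))\<^sup>2)"
      by algebra
    then show ?thesis using unit by simp
  qed
  have energy: "k\<^sup>2 / 2 * J - D * (k + 1) \<le> ?I (\<lambda>x. a x * (deriv ?f x * deriv ?f x))"
    unfolding J_def
    by (rule D[OF _ osc osc _ _ sq])
      (use k1 in \<open>auto intro!: derivative_eq_intros simp: algebra_simps\<close>)
  have "?I (\<lambda>x. ?f x * ?f x) \<le> S"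
    unfolding S_def
  proof (rule integral_le)
    show "(\<lambda>x. ?f x * ?f x) integrable_on {0..L}" "(\<lambda>x. g x * g x) integrable_on {0..L}"
      by (intro circle_smooth_integrable circle_smooth_mult g f)+
    show "?f x * ?f x \<le> g x * g x" for x
    proof -
      have "(?p x)\<^sup>2 \<le> 1" using sq[of x] zero_le_power2[of "?q x"] by linarith
      from mult_left_mono[OF this, of "(g x)\<^sup>2"] show ?thesis
        by (simp add: power2_eq_square mult_ac)
    qed
  qed
  moreover have f0: "0 \<le> ?I (\<lambda>x. ?f x * ?f x)"
    by (intro integral_nonneg circle_smooth_integrable circle_smooth_mult[OF f f]) auto
  ultimately have "C * ?I (\<lambda>x. ?f x * ?f x) \<le> \<bar>C\<bar> * S"
    by (meson abs_ge_self abs_ge_zero mult_mono order_trans)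
  also have "\<dots> < k\<^sup>2 / 2 * J - D * (k + 1)"
  proof -
    have "2 * (2 * \<bar>D\<bar> + \<bar>C\<bar> * S) / J < k" using kX by (simp add: X_def)
    then have "2 * \<bar>D\<bar> + \<bar>C\<bar> * S < k * J / 2" using Jpos by (simp add: field_simps)
    then have "k * (2 * \<bar>D\<bar> + \<bar>C\<bar> * S) < k * (k * J / 2)"
      using k1 by (intro mult_strict_left_mono) auto
    moreover have "D * (k + 1) \<le> \<bar>D\<bar> * (2 * k)" using k1 by (intro mult_mono) auto
    moreover have "1 * (\<bar>C\<bar> * S) \<le> k * (\<bar>C\<bar> * S)" using k1 S by (intro mult_right_mono) auto
    ultimately show ?thesis by (simp add: power2_eq_square algebra_simps)
  qed
  also note energy
  finally show ?thesis using that[OF f mf] by blast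
qed

section \<open>Boundedness of the sectional curvatures\<close>

context arclength_curve
begin

text \<open>
  Both directions compare with the leading term of the curvature. For the forward direction, a bound on
  the curvatures would bound \<open>\<integral> a h'\<^sup>2\<close> by a multiple of \<open>\<integral> h\<^sup>2\<close> for all \<open>h\<close> orthogonal to
  \<open>m\<close>, by homogeneity.
\<close>

theorem sectional_curvature_bdd_above_iff:
  assumes m: "m \<in> circle_smooth L" and mm: "I (\<lambda>\<theta>. m \<theta> * m \<theta>) = S" and S: "S > 0"
  shows "bdd_above {sectional_curvature \<phi> L c m h | h.
      h \<in> circle_sphere L S \<and> I (\<lambda>\<theta>. m \<theta> * h \<theta>) = 0} \<longleftrightarrow>
    (\<forall>\<theta>. \<phi> L * (m \<theta> * m \<theta>) \<le> deriv \<phi> L * S)" (is "bdd_above ?K \<longleftrightarrow> _")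
proof -
  define a where "a = (\<lambda>\<theta>. \<phi> L * (m \<theta> * m \<theta>) - deriv \<phi> L * S)"
  have a: "a \<in> circle_smooth L" unfolding a_def by (intro circle_smooth_intros m)
  obtain C where C: "\<And>h. h \<in> circle_sphere L S \<Longrightarrow> I (\<lambda>\<theta>. m \<theta> * h \<theta>) = 0 \<Longrightarrow>
      \<bar>sectional_curvature \<phi> L c m h - 1 / 2 * I (\<lambda>\<theta>. a \<theta> * (deriv h \<theta> * deriv h \<theta>))\<bar> \<le> C"
    using curvature_remainder_bounded[OF m mm] unfolding a_def by blast
  show ?thesis
  proof
    assume le: "\<forall>\<theta>. \<phi> L * (m \<theta> * m \<theta>) \<le> deriv \<phi> L * S"
    have "sectional_curvature \<phi> L c m h \<le> C"
      if h: "h \<in> circle_sphere L S" and orth: "I (\<lambda>\<theta>. m \<theta> * h \<theta>) = 0" for h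
    proof -
      have hs: "h \<in> circle_smooth L" using h by (simp add: circle_sphere_def)
      have "I (\<lambda>\<theta>. a \<theta> * (deriv h \<theta> * deriv h \<theta>)) \<le> I (\<lambda>\<theta>. 0)"
        by (intro integral_le circle_smooth_integrable circle_smooth_intros a hs)
          (use le in \<open>auto simp: a_def intro!: mult_nonpos_nonneg\<close>)
      then show ?thesis using C[OF h orth] by simp
    qed
    then show "bdd_above ?K" unfolding bdd_above_def by blast
  next
    assume "bdd_above ?K"
    then obtain M where M: "\<And>h. h \<in> circle_sphere L S \<Longrightarrow> I (\<lambda>\<theta>. m \<theta> * h \<theta>) = 0 \<Longrightarrow>
        sectional_curvature \<phi> L c m h \<le> M"
      unfolding bdd_above_def by blast
    show "\<forall>\<theta>. \<phi> L * (m \<theta> * m \<theta>) \<le> deriv \<phi> L * S"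
    proof (rule ccontr)
      assume "\<not> ?thesis"
      then obtain \<theta>\<^sub>0 where pos: "a \<theta>\<^sub>0 > 0" by (auto simp: a_def not_le)
      obtain f where f: "f \<in> circle_smooth L" and mf: "I (\<lambda>x. m x * f x) = 0"
        and big: "I (\<lambda>x. a x * (deriv f x * deriv f x)) > 2 * (M + C) / S * I (\<lambda>x. f x * f x)"
        by (rule high_energy_orthogonal[OF a m length_pos pos])
      define T where "T = I (\<lambda>x. f x * f x)"
      have "T \<noteq> 0"
      proof
        assume "T = 0"
        then have "f = (\<lambda>_. 0)"
          unfolding T_def by (rule circle_integral_square_eq_0[OF f length_pos])
        then show False using big by simp
      qed
      moreover have "T \<ge> 0" unfolding T_def
        by (intro integral_nonneg circle_smooth_integrable circle_smooth_mult f) auto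
      ultimately have T: "T > 0" by simp
      \<comment> \<open>rescale \<open>f\<close> to the sphere; the two sides of \<open>big\<close> scale alike\<close>
      define q where "q = sqrt (S / T)"
      have q: "q * q = S / T" using S T by (simp add: q_def)
      let ?h = "\<lambda>x. q * f x"
      have dh: "deriv ?h = (\<lambda>x. q * deriv f x)"
        by (rule ext DERIV_imp_deriv DERIV_cmult circle_smooth_has_derivative f)+
      have scale: "I (\<lambda>x. u x * (q * v x * (q * v x))) = S / T * I (\<lambda>x. u x * (v x * v x))" for u v
        unfolding q[symmetric] integral_mult_right[symmetric] by (simp add: mult_ac)
      have h: "?h \<in> circle_sphere L S"
        using scale[of "\<lambda>_. 1" f] T unfolding circle_sphere_def
        by (auto intro!: circle_smooth_intros f simp: T_def[symmetric])
      have orth: "I (\<lambda>x. m x * ?h x) = 0"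
        using mf by (simp add: mult.left_commute)
      have "2 * (M + C) = S / T * (2 * (M + C) / S * T)" using S T by simp
      also have "\<dots> < S / T * I (\<lambda>x. a x * (deriv f x * deriv f x))"
        using big S T unfolding T_def[symmetric] by (intro mult_strict_left_mono) auto
      also have "\<dots> = I (\<lambda>x. a x * (deriv ?h x * deriv ?h x))"
        unfolding dh scale ..
      finally have "M + C < 1 / 2 * I (\<lambda>x. a x * (deriv ?h x * deriv ?h x))" by simp
      then show False using C[OF h orth] M[OF h orth] by linarith
    qed
  qed
qed

end

theorem proposition7:
  fixes \<phi> :: "real \<Rightarrow> real" and L :: real and c :: "real \<Rightarrow> complex" and m :: "real \<Rightarrow> real"
  assumes phi_smooth: "smooth_on {0<..} \<phi>"
    and phi_pos: "\<And>x. x > 0 \<Longrightarrow> \<phi> x > 0"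
    and length_pos: "L > 0"
    and free: "free_immersion L c"
    and arclength: "arclength_param c"
    and m_smooth: "m \<in> circle_smooth L"
    and m_unit: "\<phi> L * circle_inner L m m = 1"
  defines "K \<equiv> {sectional_curvature \<phi> L c m h | h.
      h \<in> circle_smooth L \<and> \<phi> L * circle_inner L h h = 1 \<and> circle_inner L m h = 0}"
  shows "(bdd_above K \<longleftrightarrow> (sup_norm m)\<^sup>2 \<le> deriv \<phi> L / (\<phi> L)\<^sup>2) \<and>
    (bdd_above K \<longleftrightarrow>
      (\<forall>\<theta>. (m \<theta>)\<^sup>2 \<le> deriv \<phi> L * L / \<phi> L * (1 / L * integral {0..L} (\<lambda>\<theta>. (m \<theta>)\<^sup>2))))"
proof -
  have c: "c \<in> circle_smooth L"
    using free by (simp add: free_immersion_def immersion_def)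
  interpret arclength_curve \<phi> L c
    by unfold_locales (use phi_smooth phi_pos length_pos c arclength in auto)
  have phi: "\<phi> L > 0" by (rule phi_L_pos)
  have unit: "\<phi> L * circle_inner L h h = 1 \<longleftrightarrow> integral {0..L} (\<lambda>\<theta>. h \<theta> * h \<theta>) = 1 / \<phi> L" for h
    using phi unfolding circle_inner_def by (auto simp: field_simps)
  have mm: "integral {0..L} (\<lambda>\<theta>. m \<theta> * m \<theta>) = 1 / \<phi> L"
    using m_unit unfolding unit .
  have K: "K = {sectional_curvature \<phi> L c m h | h.
      h \<in> circle_sphere L (1 / \<phi> L) \<and> integral {0..L} (\<lambda>\<theta>. m \<theta> * h \<theta>) = 0}"
    unfolding K_def unit unfolding circle_sphere_def circle_inner_def by auto
  have pointwise: "\<phi> L * (m \<theta> * m \<theta>) \<le> deriv \<phi> L * (1 / \<phi> L) \<longleftrightarrow> (m \<theta>)\<^sup>2 \<le> deriv \<phi> L / (\<phi> L)\<^sup>2" for \<theta>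
    using phi by (simp add: field_simps power2_eq_square)
  have bdd: "bdd_above K \<longleftrightarrow> (\<forall>\<theta>. (m \<theta>)\<^sup>2 \<le> deriv \<phi> L / (\<phi> L)\<^sup>2)"
    using sectional_curvature_bdd_above_iff[OF m_smooth mm] phi unfolding K pointwise by simp
  have "deriv \<phi> L * L / \<phi> L * (1 / L * integral {0..L} (\<lambda>\<theta>. (m \<theta>)\<^sup>2)) = deriv \<phi> L / (\<phi> L)\<^sup>2"
    using length_pos unfolding power2_eq_square mm by simp
  then show ?thesis
    unfolding sup_norm_square_le_iff[OF m_smooth length_pos] bdd by simp
qed

end
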